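(* For all integers $k,p,t \geq 2$, there exists $\delta>0$ such that the following holds for all integers $n\ge 1$. Fix positive integers $a_1,\dots,a_p$ with $1 \leq a_1 \leq \dotsb \leq a_{p-1} \leq t$ and $a_p \leq \delta n$. Let $G$ be the complete $p$-partite graph with parts of sizes $a_1,\dots,a_p$. Then $r(G,B_{k,n}) = (p-1)(n-1)+a_1$ if and only if $a_1 = a_2 = 1$. Additionally, we may take $\delta\geq 2^{-t^{1000k^2p^2}}$.
   Context: For graphs $G,H$, the Ramsey number $r(G,H)$ is the smallest $N$ such that every graph $\Gamma$ on $N$ vertices contains $G$ as a (not necessarily induced) subgraph or its complement $\overline{\Gamma}$ contains $H$ as a (not necessarily induced) subgraph. For integers $n \geq k \geq 1$, the $k$-book $B_{k,n}$ is the graph on $n$ vertices consisting of a copy of $K_k$ (the spine) together with $n-k$ additional vertices, each adjacent to every vertex of the spine and pairwise non-adjacent.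
   Formalization: The parts are assumed listed in nondecreasing order including a_{p-1} ≤ a_p, which the displayed chain omits; without it the claim fails, e.g. p=k=t=2, (a_1,a_2)=(2,1), n even and large: r(K_{1,2},B_{2,n}) = n+1 = (n-1)+a_1 although a_1 ≠ 1. *)

theory Defs
  imports Complex_Main "HOL-Library.Ramsey"
begin

text \<open>
  A graph is a pair of a vertex set and a set of edges, the edges being two-element sets of
  vertices. \<^term>\<open>[V]\<^bsup>2\<^esup>\<close> is the set of all two-element subsets of \<open>V\<close>.
\<close>

type_synonym 'a graph = "'a set \<times> 'a set set"

abbreviation verts :: "'a graph \<Rightarrow> 'a set" where
  "verts G \<equiv> fst G"

abbreviation edges :: "'a graph \<Rightarrow> 'a set set" where
  "edges G \<equiv> snd G"

definition finite_graph :: "'a graph \<Rightarrow> bool" where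
  "finite_graph G \<longleftrightarrow> finite (verts G) \<and> edges G \<subseteq> [verts G]\<^bsup>2\<^esup>"

definition complement_graph :: "'a graph \<Rightarrow> 'a graph" where
  "complement_graph G = (verts G, [verts G]\<^bsup>2\<^esup> - edges G)"

text \<open>Containment as a subgraph up to isomorphism, not necessarily induced.\<close>

definition contains_copy :: "'a graph \<Rightarrow> 'b graph \<Rightarrow> bool" where
  "contains_copy \<Gamma> G \<longleftrightarrow>
     (\<exists>f. inj_on f (verts G) \<and> f ` verts G \<subseteq> verts \<Gamma> \<and> (\<forall>e\<in>edges G. f ` e \<in> edges \<Gamma>))"

text \<open>
  Every graph on \<open>N\<close> vertices is isomorphic to one whose vertices are natural numbers, so it
  suffices to let \<open>\<Gamma>\<close> range over those. The minimum exists for finite \<open>G\<close> and \<open>H\<close>, see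
  \<open>ramsey_number_exists\<close> below.
\<close>

definition ramsey_property :: "'a graph \<Rightarrow> 'b graph \<Rightarrow> nat \<Rightarrow> bool" where
  "ramsey_property G H N \<longleftrightarrow>
     (\<forall>\<Gamma> :: nat graph. finite_graph \<Gamma> \<and> card (verts \<Gamma>) = N \<longrightarrow>
        contains_copy \<Gamma> G \<or> contains_copy (complement_graph \<Gamma>) H)"

definition ramsey_number :: "'a graph \<Rightarrow> 'b graph \<Rightarrow> nat" where
  "ramsey_number G H = (LEAST N. ramsey_property G H N)"

text \<open>
  The \<open>k\<close>-book on \<open>n\<close> vertices has spine \<open>{..<k}\<close>. It is meant for \<open>k \<le> n\<close>; for \<open>n < k\<close> this
  yields the complete graph on \<open>n\<close> vertices.
\<close>

definition book :: "nat \<Rightarrow> nat \<Rightarrow> nat graph" where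
  "book k n = ({..<n}, {{u, v} |u v. u < k \<and> u < n \<and> v < n \<and> u \<noteq> v})"

text \<open>The \<open>i\<close>-th part consists of the pairs \<open>(i, x)\<close> with \<open>x < a i\<close>; parts are numbered from 1.\<close>

definition complete_multipartite :: "nat \<Rightarrow> (nat \<Rightarrow> nat) \<Rightarrow> (nat \<times> nat) graph" where
  "complete_multipartite p a =
     (let V = Sigma {1..p} (\<lambda>i. {..<a i})
      in (V, {{u, v} |u v. u \<in> V \<and> v \<in> V \<and> fst u \<noteq> fst v}))"

lemma finite_graph_book: "finite_graph (book k n)"
  by (auto simp: finite_graph_def book_def)

lemma finite_graph_complete_multipartite: "finite_graph (complete_multipartite p a)"
  by (auto simp: finite_graph_def complete_multipartite_def Let_def)

lemma contains_copy_if_complete: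
  assumes "finite_graph G" "finite R" "card R = card (verts G)" "R \<subseteq> verts \<Gamma>" "[R]\<^bsup>2\<^esup> \<subseteq> edges \<Gamma>"
  shows "contains_copy \<Gamma> G"
proof -
  obtain f where f: "bij_betw f (verts G) R"
    using assms by (metis finite_graph_def finite_same_card_bij)
  have "f ` e \<in> [R]\<^bsup>2\<^esup>" if "e \<in> edges G" for e
  proof -
    have "e \<subseteq> verts G" "card e = 2" "finite e"
      using that assms(1) by (auto simp: finite_graph_def nsets_def)
    then show ?thesis
      using f by (auto simp: nsets_def bij_betw_def card_image inj_on_subset)
  qed
  then have "\<forall>e\<in>edges G. f ` e \<in> edges \<Gamma>"
    using assms(5) by (meson subsetD)
  moreover have "inj_on f (verts G)" "f ` verts G \<subseteq> verts \<Gamma>"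
    using f assms(4) by (simp_all add: bij_betw_def)
  ultimately show ?thesis
    unfolding contains_copy_def by (intro exI[of _ f] conjI)
qed

lemma ramsey_number_exists:
  assumes "finite_graph G" "finite_graph H"
  shows "\<exists>N. ramsey_property G H N"
proof -
  obtain r where "1 \<le> r" and r: "\<forall>(V :: nat set) E. finite V \<and> card V \<ge> r \<longrightarrow>
      (\<exists>R \<subseteq> V. card R = card (verts G) \<and> clique R E \<or> card R = card (verts H) \<and> indep R E)"
    using ramsey2[where 'a = nat and m = "card (verts G)" and n = "card (verts H)"]
    by (elim exE conjE)
  have "contains_copy \<Gamma> G \<or> contains_copy (complement_graph \<Gamma>) H"
    if \<Gamma>: "finite_graph \<Gamma>" "card (verts \<Gamma>) = r" for \<Gamma> :: "nat graph"
  proof -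
    have fin: "finite (verts \<Gamma>)"
      using \<Gamma> by (simp add: finite_graph_def)
    obtain R where R: "R \<subseteq> verts \<Gamma>" and
      cases: "card R = card (verts G) \<and> clique R (edges \<Gamma>) \<or>
              card R = card (verts H) \<and> indep R (edges \<Gamma>)"
      using r[rule_format, of "verts \<Gamma>" "edges \<Gamma>"] fin \<Gamma>(2) by blast
    have finR: "finite R"
      using R fin finite_subset by blast
    from cases show ?thesis
    proof
      assume *: "card R = card (verts G) \<and> clique R (edges \<Gamma>)"
      then have "[R]\<^bsup>2\<^esup> \<subseteq> edges \<Gamma>"
        by (auto simp: clique_def nsets_2_eq)
      then show ?thesis
        using contains_copy_if_complete[OF assms(1) finR] * R by blast
    next
      assume *: "card R = card (verts H) \<and> indep R (edges \<Gamma>)"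
      then have "[R]\<^bsup>2\<^esup> \<subseteq> edges (complement_graph \<Gamma>)"
        using R by (auto simp: indep_def nsets_2_eq complement_graph_def)
      then have "contains_copy (complement_graph \<Gamma>) H"
        using contains_copy_if_complete[OF assms(2) finR] * R
        by (auto simp: complement_graph_def)
      then show ?thesis ..
    qed
  qed
  then show ?thesis
    unfolding ramsey_property_def by blast
qed

end

theory Submission
  imports Defs
begin

text \<open>
  The edges of \<open>\<Gamma>\<close> are called red and its non-edges blue. Put \<open>N = (p - 1) * (n - 1) + 1\<close>. If \<open>S\<close> is
  a stable set (no red edge inside) with \<open>k\<close> elements, then the vertices that miss \<open>S\<close>, that is, have
  no neighbour in \<open>S\<close>, include \<open>S\<close> itself and span a blue book with spine \<open>S\<close>. So the complement contains no
  \<open>B\<^bsub>k,n\<^esub>\<close> as long as every stable \<open>k\<close>-set is missed by fewer than \<open>n\<close> vertices.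

  \<^bold>\<open>Lower bounds.\<close> The complete \<open>(p - 1)\<close>-partite graph with classes of size \<open>n - 1\<close> shows that the
  Ramsey number exceeds \<open>(p - 1) * (n - 1)\<close>. If \<open>a 2 \<ge> 2\<close>, one class can be enlarged to
  \<open>n - 1 + a 1\<close> vertices and filled with disjoint cliques on \<open>a 1 + 1\<close> vertices. Two parts of \<open>G\<close>
  would have to lie in this class, hence in one clique, which is too small for them. Two non-adjacent
  vertices of this class have together at least \<open>a 1\<close> neighbours in it, so the spine of a book (this uses
  \<open>k \<ge> 2\<close>) misses at most \<open>n - 1\<close> vertices. Hence equality in the theorem forces \<open>a 1 = a 2 = 1\<close>.

  \<^bold>\<open>Upper bound.\<close> Let \<open>a 1 = a 2 = 1\<close> and suppose that \<open>\<Gamma>\<close> on \<open>N\<close> vertices contains neither \<open>G\<close> nor,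
  in its complement, the book. Assume for a moment that there are \<open>j \<le> p - 1\<close> stable \<open>k\<close>-sets
  such that every vertex misses one of them. Then there are at most \<open>j * (n - 1) < N\<close> vertices, a
  contradiction. The proof approximates this situation.

    \<^item> For \<open>j < p - 1\<close> stable sets that are completely joined to one another, the count leaves a linear
      number of vertices with many neighbours in each of them. By the pigeonhole principle linearly many
      of these have the same neighbours, and since large sets contain large stable sets
      (\<open>large_has_stable\<close>), the system of sets can be extended to \<open>j + 1\<close> smaller ones. This ends with
      \<open>p - 1\<close> sets \<open>A\<^sub>i\<close>, for which only few vertices can have \<open>t\<close> neighbours in each \<open>A\<^sub>i\<close>, since
      these would produce \<open>G\<close>. After passing to suitable subsets of the \<open>A\<^sub>i\<close>, almost every vertex misses
      one of them entirely (\<open>nearly_covering_blowup\<close>).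

    \<^item> The count is now almost tight. Therefore the sets of vertices missing \<open>A\<^sub>i\<close> have almost \<open>n\<close>
      elements and almost partition the vertices. After removal of few vertices one gets
      classes \<open>C\<^sub>i\<close> with few neighbours of each member inside the class (otherwise \<open>G\<close> appears) and few
      non-neighbours in the other classes (otherwise a stable \<open>k\<close>-set is missed by too many
      vertices); see \<open>stability_core\<close> and \<open>few_exceptional\<close>.

    \<^item> Exactness (\<open>no_stable_partition\<close>). Let \<open>U\<^sub>j\<close> consist of the vertices with few neighbours in \<open>C\<^sub>j\<close>
      and let \<open>E\<close> be the set of vertices lying in two of the \<open>U\<^sub>j\<close>. The \<open>U\<^sub>j\<close> cover everything, as a
      vertex with many neighbours in each class completes a copy of \<open>G\<close>. Similarly, every edge between
      \<open>C\<^sub>j\<close> and \<open>U\<^sub>j\<close> ends in \<open>E\<close>. As the members of \<open>E \<inter> U\<^sub>j\<close> have few neighbours in \<open>C\<^sub>j\<close>, some \<open>k\<close>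
      vertices of \<open>C\<^sub>j\<close> have together at most \<open>|E| / p\<close> neighbours in \<open>U\<^sub>j\<close>, so
      \<open>|U\<^sub>j| \<le> n - 1 + |E| / p\<close>. But the sizes \<open>|U\<^sub>j|\<close> add up to at least \<open>N + |E|\<close>.

  The sets \<open>A\<^sub>i\<close> have sizes polynomial in \<open>t\<close> with an exponent of order at most \<open>k\<^sup>2 p\<^sup>2\<close>, and the pigeonhole steps
  lose factors exponential in these sizes, which gives the shape of the bound on \<open>\<delta>\<close>.
\<close>

section \<open>Counting\<close>

lemma disjoint_blocks:
  fixes A :: "'a set"
  assumes "finite A" "q * l \<le> card A"
  shows "\<exists>P. (\<forall>i<q. P i \<subseteq> A \<and> card (P i) = l) \<and> (\<forall>i<q. \<forall>j<q. i \<noteq> j \<longrightarrow> P i \<inter> P j = {})"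
  using assms
proof (induction q arbitrary: A)
  case 0
  then show ?case by simp
next
  case (Suc q)
  obtain B where B: "B \<subseteq> A" "card B = l" "finite B"
    using Suc.prems obtain_subset_with_card_n[of l A] by auto
  have "q * l \<le> card (A - B)"
    using Suc.prems B by (simp add: card_Diff_subset)
  then obtain P where P: "\<forall>i<q. P i \<subseteq> A - B \<and> card (P i) = l"
      "\<forall>i<q. \<forall>j<q. i \<noteq> j \<longrightarrow> P i \<inter> P j = {}"
    using Suc.IH[of "A - B"] Suc.prems by auto
  show ?case
  proof (rule exI[of _ "P(q := B)"], intro conjI allI impI)
    fix i assume "i < Suc q"
    then show "(P(q := B)) i \<subseteq> A" "card ((P(q := B)) i) = l"
      using P B by (auto simp: less_Suc_eq)
  next
    fix i j assume ij: "i < Suc q" "j < Suc q" "i \<noteq> j"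
    have "P i \<inter> B = {}" if "i < q" for i
      using P(1) that by blast
    then show "(P(q := B)) i \<inter> (P(q := B)) j = {}"
      using P(2) ij by (cases "i = q"; cases "j = q") (simp_all add: less_Suc_eq Int_commute)
  qed
qed

lemma large_fibre:
  fixes f :: "'a \<Rightarrow> 'b"
  assumes "finite W" "finite P" "f ` W \<subseteq> P" "P \<noteq> {}" "card P * r \<le> card W" "1 \<le> r"
  shows "\<exists>y\<in>P. r \<le> card {w \<in> W. f w = y}"
proof (rule ccontr)
  assume "\<not> ?thesis"
  then have small: "card {w \<in> W. f w = y} \<le> r - 1" if "y \<in> P" for y
    using that by fastforce
  have "card W = (\<Sum>w\<in>W. 1)" by simp
  also have "\<dots> = (\<Sum>y\<in>P. sum (\<lambda>_. 1) {w \<in> W. f w = y})"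
    using sum.group[OF assms(1-3), of "\<lambda>_. 1::nat"] by simp
  also have "\<dots> \<le> (\<Sum>y\<in>P. r - 1)"
    using small by (intro sum_mono) simp
  finally have "card W \<le> card P * (r - 1)" by simp
  moreover have "card P > 0" using assms by (simp add: card_gt_0_iff)
  ultimately show False using assms(5,6)
    by (metis diff_less leD less_le_trans mult_less_cancel1 zero_less_one)
qed

lemma sum_card_swap:
  assumes "finite I" "finite Y"
  shows "(\<Sum>i\<in>I. card {y \<in> Y. Q i y}) = (\<Sum>y\<in>Y. card {i \<in> I. Q i y})"
proof -
  have "(\<Sum>i\<in>I. card {y \<in> Y. Q i y}) = (\<Sum>i\<in>I. \<Sum>y\<in>Y. if Q i y then 1 else 0)"
    using assms by (intro sum.cong) (auto simp: sum.If_cases Int_def)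
  also have "\<dots> = (\<Sum>y\<in>Y. \<Sum>i\<in>I. if Q i y then 1 else 0)"
    by (rule sum.swap)
  also have "\<dots> = (\<Sum>y\<in>Y. card {i \<in> I. Q i y})"
    using assms by (intro sum.cong) (auto simp: sum.If_cases Int_def)
  finally show ?thesis .
qed

section \<open>Stable sets and completely joined sets\<close>

locale simple_graph =
  fixes V :: "'a set" and R :: "'a \<Rightarrow> 'a \<Rightarrow> bool"
  assumes finite_V: "finite V"
    and sym: "R x y \<Longrightarrow> R y x"
    and irrefl: "\<not> R x x"
begin

definition nbrs :: "'a \<Rightarrow> 'a set \<Rightarrow> 'a set" where
  "nbrs x X = {y \<in> X. R x y}"

definition stable :: "'a set \<Rightarrow> bool" where
  "stable S \<longleftrightarrow> (\<forall>x\<in>S. \<forall>y\<in>S. \<not> R x y)"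

definition complete_to :: "'a set \<Rightarrow> 'a set \<Rightarrow> bool" where
  "complete_to X Y \<longleftrightarrow> (\<forall>x\<in>X. \<forall>y\<in>Y. R x y)"

text \<open>
  For stable \<open>S\<close> this includes \<open>S\<close> itself, so that for \<open>card S = k\<close> it is the vertex set of the largest
  \<open>k\<close>-book in the complement with spine \<open>S\<close>.
\<close>

definition miss :: "'a set \<Rightarrow> 'a set" where
  "miss S = {v \<in> V. \<forall>x\<in>S. \<not> R v x}"

lemma complete_to_sym: "complete_to X Y \<Longrightarrow> complete_to Y X"
  using sym by (auto simp: complete_to_def)

lemma complete_to_mono: "complete_to X Y \<Longrightarrow> X' \<subseteq> X \<Longrightarrow> Y' \<subseteq> Y \<Longrightarrow> complete_to X' Y'"
  by (auto simp: complete_to_def)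

lemma stable_subset: "stable S \<Longrightarrow> S' \<subseteq> S \<Longrightarrow> stable S'"
  by (auto simp: stable_def)

lemma miss_antimono: "S \<subseteq> S' \<Longrightarrow> miss S' \<subseteq> miss S"
  by (auto simp: miss_def)

lemma finite_nbrs [simp]: "finite X \<Longrightarrow> finite (nbrs x X)"
  by (simp add: nbrs_def)

lemma nbrs_subset: "nbrs x X \<subseteq> X"
  by (auto simp: nbrs_def)

lemma finite_miss [simp]: "finite (miss S)"
  using finite_V by (simp add: miss_def)

lemma card_nbrs_compl:
  assumes "finite X"
  shows "card (nbrs x X) + card {y \<in> X. \<not> R x y} = card X"
proof -
  have "card X = card (nbrs x X \<union> {y \<in> X. \<not> R x y})"
    by (rule arg_cong[of _ _ card]) (auto simp: nbrs_def)
  also have "\<dots> = card (nbrs x X) + card {y \<in> X. \<not> R x y}"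
    using assms by (intro card_Un_disjoint) (auto simp: nbrs_def)
  finally show ?thesis by simp
qed

text \<open>
  Greedy choice: each chosen vertex rules out itself and at most \<open>d\<close> neighbours.
\<close>

lemma stable_if_bounded_degree:
  assumes "finite X" "\<And>x. x \<in> X \<Longrightarrow> card (nbrs x X) \<le> d" "s * (d + 1) \<le> card X"
  shows "\<exists>S\<subseteq>X. stable S \<and> card S = s"
  using assms
proof (induction s arbitrary: X)
  case 0
  show ?case by (intro exI[of _ "{}"]) (simp add: stable_def)
next
  case (Suc s)
  then have "X \<noteq> {}" by auto
  then obtain x where x: "x \<in> X" by blast
  define X' where "X' = X - insert x (nbrs x X)"
  have "card (insert x (nbrs x X)) \<le> d + 1"
    using Suc.prems(1,2) x by (simp add: card_insert_if le_SucI)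
  moreover have "card X' = card X - card (insert x (nbrs x X))"
    unfolding X'_def using Suc.prems(1) x nbrs_subset by (intro card_Diff_subset) auto
  ultimately have "s * (d + 1) \<le> card X'"
    using Suc.prems(3) by simp
  moreover have "card (nbrs y X') \<le> d" if "y \<in> X'" for y
  proof -
    have "card (nbrs y X') \<le> card (nbrs y X)"
      using Suc.prems(1) by (intro card_mono) (auto simp: nbrs_def X'_def)
    then show ?thesis using Suc.prems(2)[of y] that by (simp add: X'_def)
  qed
  ultimately obtain S where S: "S \<subseteq> X'" "stable S" "card S = s"
    using Suc.IH[of X'] Suc.prems(1) by (auto simp: X'_def)
  have "stable (insert x S)"
    using S sym irrefl by (auto simp: stable_def X'_def nbrs_def)
  moreover have "card (insert x S) = Suc s"
    using S Suc.prems(1) by (subst card_insert_disjoint) (auto simp: X'_def intro: finite_subset)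
  ultimately show ?case
    using S x by (intro exI[of _ "insert x S"]) (auto simp: X'_def)
qed

text \<open>
  A set without a stable \<open>s\<close>-set has, by the greedy bound above, a vertex adjacent to about a proportion
  \<open>1 / s\<close> of it. Moving to its neighbourhood \<open>q\<close> times yields the clique \<open>Q\<close>, and what remains is \<open>M\<close>.
  Unlike in Ramsey's theorem, the common neighbourhood \<open>M\<close> of the clique stays proportional to \<open>W\<close>.
\<close>

lemma clique_or_stable:
  assumes "finite W" "s ^ q * m \<le> card W" "\<And>S. S \<subseteq> W \<Longrightarrow> stable S \<Longrightarrow> card S \<noteq> s" "1 \<le> m"
  shows "\<exists>Q M. Q \<subseteq> W \<and> M \<subseteq> W \<and> card Q = q \<and> m \<le> card M \<and>
           (\<forall>x\<in>Q. \<forall>y\<in>Q. x \<noteq> y \<longrightarrow> R x y) \<and> complete_to Q M"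
  using assms
proof (induction q arbitrary: W)
  case 0
  then show ?case by (intro exI[of _ "{}"] exI[of _ W]) (simp add: complete_to_def)
next
  case (Suc q)
  have s: "s > 0"
    using Suc.prems(3)[of "{}"] by (cases s) (auto simp: stable_def)
  have "\<exists>x\<in>W. s ^ q * m \<le> card (nbrs x W)"
  proof (rule ccontr)
    assume "\<not> ?thesis"
    then have "card (nbrs x W) \<le> s ^ q * m - 1" if "x \<in> W" for x
      using that by fastforce
    moreover have "s ^ q * m > 0" using s Suc.prems(4) by simp
    then have "s ^ q * m - 1 + 1 = s ^ q * m" by simp
    then have "s * (s ^ q * m - 1 + 1) \<le> card W"
      using Suc.prems(2) by (simp only: power_Suc mult.assoc)
    ultimately obtain S where "S \<subseteq> W" "stable S" "card S = s"
      using stable_if_bounded_degree[OF Suc.prems(1)] by blast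
    then show False using Suc.prems(3) by blast
  qed
  then obtain x where x: "x \<in> W" "s ^ q * m \<le> card (nbrs x W)" by blast
  obtain Q M where QM: "Q \<subseteq> nbrs x W" "M \<subseteq> nbrs x W" "card Q = q" "m \<le> card M"
      "\<forall>x\<in>Q. \<forall>y\<in>Q. x \<noteq> y \<longrightarrow> R x y" "complete_to Q M"
  proof -
    have "card S \<noteq> s" if "S \<subseteq> nbrs x W" "stable S" for S
      using that Suc.prems(3)[of S] nbrs_subset[of x W] by blast
    then show ?thesis
      using Suc.IH[of "nbrs x W"] x(2) Suc.prems(1,4) that by auto
  qed
  have "x \<notin> Q" using QM(1) irrefl by (auto simp: nbrs_def)
  moreover have "finite Q" using QM(1) Suc.prems(1) finite_nbrs finite_subset by blast
  ultimately have "card (insert x Q) = Suc q" using QM(3) by simp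
  moreover have "\<forall>a\<in>insert x Q. \<forall>b\<in>insert x Q. a \<noteq> b \<longrightarrow> R a b"
    using QM(1,5) sym by (auto simp: nbrs_def)
  moreover have "complete_to (insert x Q) M"
    using QM(2,6) by (auto simp: nbrs_def complete_to_def)
  ultimately show ?case
    using QM x nbrs_subset[of x W]
    by (intro exI[of _ "insert x Q"] exI[of _ M]) auto
qed

text \<open>
  The averaging argument behind all choices of a random subset: \<open>q\<close> disjoint blocks of size \<open>l\<close> in \<open>A\<close>
  are hit by the neighbourhood of each \<open>y\<close> at most \<open>d\<close> times in total, so an average block is hit
  by a proportion of at most \<open>d / q\<close> of \<open>Y\<close>.
\<close>

lemma block_avoiding_most:
  assumes "finite A" "finite Y" "q * l \<le> card A" "\<And>y. y \<in> Y \<Longrightarrow> card (nbrs y A) \<le> d" "1 \<le> q"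
  shows "\<exists>S\<subseteq>A. card S = l \<and> q * card {y \<in> Y. \<exists>x\<in>S. R y x} \<le> d * card Y"
proof -
  obtain P where P: "\<forall>i<q. P i \<subseteq> A \<and> card (P i) = l"
      "\<forall>i<q. \<forall>j<q. i \<noteq> j \<longrightarrow> P i \<inter> P j = {}"
    using disjoint_blocks[OF assms(1,3)] by blast
  let ?hit = "\<lambda>i y. \<exists>x\<in>P i. R y x"
  have hits: "card {i \<in> {..<q}. ?hit i y} \<le> d" if y: "y \<in> Y" for y
  proof -
    define h where "h = (\<lambda>i. SOME x. x \<in> P i \<and> R y x)"
    have h: "h i \<in> P i \<and> R y (h i)" if "i \<in> {i \<in> {..<q}. ?hit i y}" for i
      unfolding h_def by (rule someI_ex) (use that in blast)
    have "inj_on h {i \<in> {..<q}. ?hit i y}"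
      using h P(2) by (intro inj_onI) (metis (mono_tags, lifting) IntI empty_iff lessThan_iff mem_Collect_eq)
    moreover have "h ` {i \<in> {..<q}. ?hit i y} \<subseteq> nbrs y A"
      using h P(1) by (fastforce simp: nbrs_def)
    ultimately have "card {i \<in> {..<q}. ?hit i y} \<le> card (nbrs y A)"
      by (rule card_inj_on_le) (simp add: assms(1))
    then show ?thesis using assms(4)[OF y] by simp
  qed
  have "\<exists>i<q. q * card {y \<in> Y. ?hit i y} \<le> d * card Y"
  proof (rule ccontr)
    assume "\<not> ?thesis"
    then have "(\<Sum>i<q. d * card Y) < (\<Sum>i<q. q * card {y \<in> Y. ?hit i y})"
      using assms(5) by (intro sum_strict_mono) (auto simp: not_le lessThan_empty_iff)
    also have "\<dots> = q * (\<Sum>y\<in>Y. card {i \<in> {..<q}. ?hit i y})"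
      using sum_card_swap[of "{..<q}" Y ?hit] assms(2) by (simp add: sum_distrib_left[symmetric])
    also have "\<dots> \<le> q * (\<Sum>y\<in>Y. d)"
      using hits by (intro mult_left_mono sum_mono) auto
    finally show False by (simp add: mult.commute)
  qed
  then show ?thesis using P(1) by blast
qed

text \<open>
  There are at most \<open>2 ^ (s * card J)\<close> possible neighbourhoods inside the union of the \<open>A j\<close>, so one of
  them is shared by many members of \<open>W\<close>.
\<close>

lemma common_trace:
  assumes "finite J" "finite W" "\<And>j. j \<in> J \<Longrightarrow> finite (A j)" "\<And>j. j \<in> J \<Longrightarrow> card (A j) \<le> s"
    and "\<And>w j. w \<in> W \<Longrightarrow> j \<in> J \<Longrightarrow> c \<le> card (nbrs w (A j))"
    and "2 ^ (s * card J) * r \<le> card W" "1 \<le> r"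
  shows "\<exists>W' A'. W' \<subseteq> W \<and> r \<le> card W' \<and>
           (\<forall>j\<in>J. A' j \<subseteq> A j \<and> card (A' j) = c \<and> complete_to W' (A' j))"
proof -
  define U where "U = (\<Union>j\<in>J. A j)"
  have finU: "finite U" using assms by (simp add: U_def)
  have "card U \<le> (\<Sum>j\<in>J. card (A j))"
    unfolding U_def using assms(1) by (rule card_UN_le)
  also have "\<dots> \<le> (\<Sum>j\<in>J. s)" using assms(4) by (rule sum_mono)
  finally have "card U \<le> s * card J" by (simp add: mult.commute)
  then have "card (Pow U) * r \<le> 2 ^ (s * card J) * r"
    by (simp add: card_Pow finU)
  then have "card (Pow U) * r \<le> card W" using assms(6) by linarith
  then obtain B where B: "r \<le> card {w \<in> W. nbrs w U = B}"
    using large_fibre[of W "Pow U" "\<lambda>w. nbrs w U" r] assms(2,7) finU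
    by (auto simp: nbrs_def)
  define W' where "W' = {w \<in> W. nbrs w U = B}"
  obtain w where w: "w \<in> W'"
    using B assms(7) unfolding W'_def[symmetric] by fastforce
  have "\<exists>A'. A' \<subseteq> nbrs w (A j) \<and> card A' = c" if "j \<in> J" for j
    using assms(5)[of w j] w that obtain_subset_with_card_n[of c "nbrs w (A j)"]
    by (auto simp: W'_def)
  then obtain A' where A': "\<And>j. j \<in> J \<Longrightarrow> A' j \<subseteq> nbrs w (A j) \<and> card (A' j) = c"
    by metis
  have "complete_to W' (A' j)" if "j \<in> J" for j
  proof -
    have "A' j \<subseteq> nbrs w U" using A'[OF that] that by (auto simp: nbrs_def U_def)
    moreover have "nbrs w U = nbrs w' U" if "w' \<in> W'" for w'
      using that w by (simp add: W'_def)
    ultimately show ?thesis by (fastforce simp: complete_to_def nbrs_def)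
  qed
  moreover have "A' j \<subseteq> A j \<and> card (A' j) = c" if "j \<in> J" for j
    using A'[OF that] nbrs_subset[of w "A j"] by blast
  moreover have "W' \<subseteq> W" "r \<le> card W'" using B by (auto simp: W'_def)
  ultimately show ?thesis by blast
qed

end

section \<open>Graphs avoiding the multipartite graph and the book\<close>

text \<open>
  The situation that has to be refuted. The parts of a forbidden complete multipartite graph are indexed
  by \<open>{..<p}\<close> in an arbitrary order: \<open>x\<close> and \<open>y\<close> index the two parts of size \<open>1\<close>, \<open>z\<close> the large part of
  size \<open>m\<close>, and the other parts are given size \<open>t\<close>. The free choice of \<open>x\<close>, \<open>y\<close> and \<open>z\<close> lets a part keep
  the index of the class in which it is found.
\<close>

locale goodness = simple_graph +
  fixes k p t m n :: nat
  assumes card_V: "card V = (p - 1) * (n - 1) + 1"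
    and pars: "1 \<le> k" "3 \<le> p" "1 \<le> t" "1 \<le> m" "1 \<le> n"
    and no_book: "\<And>S. S \<subseteq> V \<Longrightarrow> stable S \<Longrightarrow> card S = k \<Longrightarrow> card (miss S) < n"
    and no_copy: "\<And>T x y z. x < p \<Longrightarrow> y < p \<Longrightarrow> z < p \<Longrightarrow> distinct [x, y, z] \<Longrightarrow>
        (\<And>i. i < p \<Longrightarrow> T i \<subseteq> V) \<Longrightarrow>
        (\<And>i j. i < p \<Longrightarrow> j < p \<Longrightarrow> i \<noteq> j \<Longrightarrow> complete_to (T i) (T j)) \<Longrightarrow>
        1 \<le> card (T x) \<Longrightarrow> 1 \<le> card (T y) \<Longrightarrow> m \<le> card (T z) \<Longrightarrow>
        (\<And>i. i < p \<Longrightarrow> i \<notin> {x, y, z} \<Longrightarrow> t \<le> card (T i)) \<Longrightarrow> False"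
begin

text \<open>
  Often only one part of size \<open>1\<close> is needed, as \<open>t \<ge> 1\<close> takes care of the other.
\<close>

lemma no_copy_single:
  assumes "x < p" "z < p" "x \<noteq> z" "\<And>i. i < p \<Longrightarrow> T i \<subseteq> V"
    and "\<And>i j. i < p \<Longrightarrow> j < p \<Longrightarrow> i \<noteq> j \<Longrightarrow> complete_to (T i) (T j)"
    and "1 \<le> card (T x)" "m \<le> card (T z)" "\<And>i. i < p \<Longrightarrow> i \<notin> {x, z} \<Longrightarrow> t \<le> card (T i)"
  shows False
proof -
  have "card {..<p} > card {x, z}" using pars assms(3) by simp
  then obtain y where y: "y < p" "y \<noteq> x" "y \<noteq> z"
    by (metis card_mono finite.emptyI finite.insertI insert_iff leD lessThan_iff subsetI)
  have "1 \<le> card (T y)" using assms(8)[of y] y pars by simp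
  then show False
    using no_copy[of x y z T] assms y by auto
qed

lemma card_miss:
  assumes "S \<subseteq> V" "stable S" "k \<le> card S"
  shows "card (miss S) < n"
proof -
  obtain S' where S': "S' \<subseteq> S" "card S' = k"
    using assms(3) obtain_subset_with_card_n by metis
  have "card (miss S) \<le> card (miss S')"
    using S'(1) by (intro card_mono miss_antimono) auto
  also have "\<dots> < n"
    using S' assms stable_subset by (intro no_book) auto
  finally show ?thesis .
qed

lemma card_V_eq: "card V = (p - 2) * (n - 1) + n"
proof -
  have "p - 1 = Suc (p - 2)" "n = Suc (n - 1)" using pars by auto
  then show ?thesis using card_V by (metis add.commute add_Suc_right mult_Suc plus_1_eq_Suc add.assoc)
qed

lemma card_V_le: "card V \<le> p * n"
proof -
  have "(p - 1) * (n - 1) \<le> (p - 1) * n" by (intro mult_left_mono) auto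
  moreover have "p * n = (p - 1) * n + n" using pars by (cases p) auto
  ultimately show ?thesis using card_V pars by linarith
qed

text \<open>
  Otherwise \<open>W\<close> contains a clique on \<open>(p - 1) * t\<close> vertices joined to \<open>m\<close> further ones, and cutting the
  clique into \<open>p - 1\<close> blocks of size \<open>t\<close> yields a forbidden multipartite graph.
\<close>

lemma large_has_stable:
  assumes "W \<subseteq> V" "1 \<le> s" "s ^ (p * t) * m \<le> card W"
  shows "\<exists>S\<subseteq>W. stable S \<and> card S = s"
proof (rule ccontr)
  assume *: "\<not> ?thesis"
  let ?q = "(p - 1) * t"
  have finW: "finite W" using assms(1) finite_V finite_subset by blast
  have "s ^ ?q * m \<le> s ^ (p * t) * m"
    using assms(2) by (intro mult_right_mono power_increasing) auto
  then have "s ^ ?q * m \<le> card W" using assms(3) by linarith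
  then obtain Q M where QM: "Q \<subseteq> W" "M \<subseteq> W" "card Q = ?q" "m \<le> card M"
       "\<forall>x\<in>Q. \<forall>y\<in>Q. x \<noteq> y \<longrightarrow> R x y" "complete_to Q M"
    using clique_or_stable[OF finW, of s ?q m] * pars(4) by blast
  have "finite Q" using QM(1) finW finite_subset by blast
  then obtain P where P: "\<forall>i<p-1. P i \<subseteq> Q \<and> card (P i) = t"
      "\<forall>i<p-1. \<forall>j<p-1. i \<noteq> j \<longrightarrow> P i \<inter> P j = {}"
    using disjoint_blocks[of Q "p - 1" t] QM(3) by auto
  have PQ: "complete_to (P i) (P j)" if "i < p - 1" "j < p - 1" "i \<noteq> j" for i j
    using P that QM(5) unfolding complete_to_def by (metis disjoint_iff subsetD)
  have PM: "complete_to (P i) M" if "i < p - 1" for i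
    using P(1) that QM(6) complete_to_mono by blast
  show False
  proof (rule no_copy_single[of 0 "p - 1" "\<lambda>i. if i < p - 1 then P i else M"])
    fix i assume "i < p"
    have "P i \<subseteq> V" if "i < p - 1"
      using P(1) that QM(1) assms(1) by blast
    then show "(if i < p - 1 then P i else M) \<subseteq> V"
      using QM(2) assms(1) by auto
  next
    fix i j assume "i < p" "j < p" "i \<noteq> j"
    then show "complete_to (if i < p - 1 then P i else M) (if j < p - 1 then P j else M)"
      using PQ PM complete_to_sym by auto
  qed (use pars P QM(4) in auto)
qed

section \<open>Blow-ups of cliques\<close>

text \<open>
  A vertex with fewer than \<open>c\<close> neighbours in \<open>A i\<close> misses most of the \<open>h * c\<close> disjoint blocks of size \<open>s\<close>
  in \<open>A i\<close>. Replacing each \<open>A i\<close> by an average block, all but a proportion \<open>j / h\<close> of the vertices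
  either have at least \<open>c\<close> neighbours in every \<open>A i\<close> or miss one of the blocks completely.
\<close>

lemma cover_by_miss:
  assumes A: "\<And>i. i < j \<Longrightarrow> A i \<subseteq> V \<and> s * (h * c) \<le> card (A i)"
    and "1 \<le> h" "1 \<le> c"
  shows "\<exists>S. (\<forall>i<j. S i \<subseteq> A i \<and> card (S i) = s) \<and>
    h * card (V - {v \<in> V. \<forall>i<j. c \<le> card (nbrs v (A i))} - (\<Union>i<j. miss (S i))) \<le> j * card V"
proof -
  define B where "B = (\<lambda>i. {v \<in> V. card (nbrs v (A i)) < c})"
  have "\<exists>S\<subseteq>A i. card S = s \<and> h * card {y \<in> B i. \<exists>x\<in>S. R y x} \<le> card V" if "i < j" for i
  proof -
    have "finite (A i)" using A that finite_V finite_subset by blast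
    moreover have "finite (B i)" using finite_V by (simp add: B_def)
    moreover have "(h * c) * s \<le> card (A i)" using A[OF that] by (simp add: mult_ac)
    moreover have "1 \<le> h * c" using assms by simp
    ultimately obtain S where S: "S \<subseteq> A i" "card S = s"
        "h * c * card {y \<in> B i. \<exists>x\<in>S. R y x} \<le> c * card (B i)"
      using block_avoiding_most[of "A i" "B i" "h * c" s c] by (fastforce simp: B_def)
    have "c * (h * card {y \<in> B i. \<exists>x\<in>S. R y x}) \<le> c * card (B i)"
      using S(3) by (simp add: mult_ac)
    then have "h * card {y \<in> B i. \<exists>x\<in>S. R y x} \<le> card (B i)"
      using assms(3) by simp
    also have "\<dots> \<le> card V"
      using finite_V by (intro card_mono) (auto simp: B_def)
    finally show ?thesis using S by blast
  qed
  then obtain S where S: "\<And>i. i < j \<Longrightarrow> S i \<subseteq> A i \<and> card (S i) = s \<and>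
      h * card {y \<in> B i. \<exists>x\<in>S i. R y x} \<le> card V"
    by metis
  define X where "X = V - {v \<in> V. \<forall>i<j. c \<le> card (nbrs v (A i))} - (\<Union>i<j. miss (S i))"
  have "X \<subseteq> (\<Union>i<j. {y \<in> B i. \<exists>x\<in>S i. R y x})"
    by (auto simp: X_def B_def miss_def not_le)
  then have "card X \<le> card (\<Union>i<j. {y \<in> B i. \<exists>x\<in>S i. R y x})"
    using finite_V by (intro card_mono) (auto simp: B_def)
  also have "\<dots> \<le> (\<Sum>i<j. card {y \<in> B i. \<exists>x\<in>S i. R y x})"
    by (intro card_UN_le) simp
  finally have "h * card X \<le> h * (\<Sum>i<j. card {y \<in> B i. \<exists>x\<in>S i. R y x})"
    by (rule mult_left_mono) simp
  also have "\<dots> = (\<Sum>i<j. h * card {y \<in> B i. \<exists>x\<in>S i. R y x})"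
    by (rule sum_distrib_left)
  also have "\<dots> \<le> (\<Sum>i<j. card V)"
    using S by (intro sum_mono) auto
  finally have "h * card X \<le> j * card V" by simp
  then show ?thesis using S unfolding X_def by blast
qed

lemma card_Union_miss:
  assumes "\<And>i. i < j \<Longrightarrow> S i \<subseteq> V \<and> stable (S i) \<and> k \<le> card (S i)"
  shows "card (\<Union>i<j. miss (S i)) \<le> j * (n - 1)"
proof -
  have "card (\<Union>i<j. miss (S i)) \<le> (\<Sum>i<j. card (miss (S i)))"
    by (intro card_UN_le) simp
  also have "\<dots> \<le> (\<Sum>i<j. n - 1)"
  proof (intro sum_mono)
    fix i assume "i \<in> {..<j}"
    then have "card (miss (S i)) < n" using assms by (intro card_miss) auto
    then show "card (miss (S i)) \<le> n - 1" by simp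
  qed
  finally show ?thesis by simp
qed

text \<open>
  Induction on the number \<open>j\<close> of sets. The blocks \<open>S i\<close> from \<open>cover_by_miss\<close> are missed by at most
  \<open>j * (n - 1) \<le> card V - n\<close> vertices altogether. So the set \<open>W\<close> of vertices with at least
  \<open>\<sigma> (Suc j)\<close> neighbours in each \<open>A i\<close> has at least \<open>n / 2\<close> elements. Many of them share
  \<open>\<sigma> (Suc j)\<close> neighbours in each \<open>A i\<close>, and a stable set among those becomes the new member.
\<close>

lemma blowup_exists:
  assumes \<sigma>: "\<And>j. j < p - 1 \<Longrightarrow> \<sigma> j = s * h * \<sigma> (Suc j)" "\<And>j. j \<le> p - 1 \<Longrightarrow> 1 \<le> \<sigma> j \<and> \<sigma> j \<le> b"
    and s: "k \<le> s" and h: "2 * p * p \<le> h"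
    and big: "2 * (2 ^ (b * p) * (b ^ (p * t) * m)) \<le> n"
    and "j \<le> p - 1"
  shows "\<exists>A. (\<forall>i<j. A i \<subseteq> V \<and> stable (A i) \<and> card (A i) = \<sigma> j) \<and>
             (\<forall>i<j. \<forall>l<j. i \<noteq> l \<longrightarrow> complete_to (A i) (A l))"
  using \<open>j \<le> p - 1\<close>
proof (induction j)
  case 0
  then show ?case by simp
next
  case (Suc j)
  then obtain A where A: "\<forall>i<j. A i \<subseteq> V \<and> stable (A i) \<and> card (A i) = \<sigma> j"
       "\<forall>i<j. \<forall>l<j. i \<noteq> l \<longrightarrow> complete_to (A i) (A l)"
    by auto
  define c where "c = \<sigma> (Suc j)"
  have c: "1 \<le> c" "c \<le> b" "\<sigma> j = s * (h * c)" "\<sigma> j \<le> b"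
    using \<sigma>(1)[of j] \<sigma>(2)[of j] \<sigma>(2)[of "Suc j"] Suc.prems by (simp_all add: c_def mult_ac)
  have h1: "1 \<le> h" using h pars by (cases h) auto
  define W where "W = {v \<in> V. \<forall>i<j. c \<le> card (nbrs v (A i))}"
  obtain S where S: "\<forall>i<j. S i \<subseteq> A i \<and> card (S i) = s"
      "h * card (V - W - (\<Union>i<j. miss (S i))) \<le> j * card V"
    using cover_by_miss[of j A s h c] A(1) c h1 unfolding W_def by auto
  let ?D = "V - W - (\<Union>i<j. miss (S i))"
  have "card (\<Union>i<j. miss (S i)) \<le> j * (n - 1)"
    using S(1) A(1) s stable_subset by (intro card_Union_miss) blast
  also have "\<dots> \<le> (p - 2) * (n - 1)" using Suc.prems by (intro mult_right_mono) auto
  finally have U: "card (\<Union>i<j. miss (S i)) \<le> (p - 2) * (n - 1)" .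
  have finW: "finite W" using finite_V by (simp add: W_def)
  have "card V \<le> card (W \<union> ?D \<union> (\<Union>i<j. miss (S i)))"
    using finite_V finW by (intro card_mono) auto
  also have "\<dots> \<le> card W + card ?D + card (\<Union>i<j. miss (S i))"
    by (meson add_mono card_Un_le le_trans order_refl)
  finally have n: "n \<le> card W + card ?D" using U card_V_eq by linarith
  have "j * card V \<le> p * (p * n)" using Suc.prems by (intro mult_mono card_V_le) auto
  then have "2 * (h * card ?D) \<le> (2 * p * p) * n" using S(2) by (simp add: mult_ac)
  also have "\<dots> \<le> h * n" using h by (intro mult_right_mono) auto
  finally have "h * (2 * card ?D) \<le> h * n" by (simp add: mult_ac)
  then have "2 * card ?D \<le> n" using h1 by simp
  then have W: "n \<le> 2 * card W" using n by linarith
  have "2 ^ (b * card {..<j}) * (b ^ (p * t) * m) \<le> 2 ^ (b * p) * (b ^ (p * t) * m)"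
    using Suc.prems by (intro mult_right_mono power_increasing) auto
  also have "\<dots> \<le> card W" using big W by linarith
  finally have "2 ^ (b * card {..<j}) * (b ^ (p * t) * m) \<le> card W" .
  moreover have "1 \<le> b ^ (p * t) * m" using c pars by simp
  moreover have "finite (A i)" if "i < j" for i using A(1) that finite_V finite_subset by blast
  moreover have "c \<le> card (nbrs w (A i))" if "w \<in> W" "i \<in> {..<j}" for w i
    using that by (simp add: W_def)
  moreover have "card (A i) \<le> b" if "i \<in> {..<j}" for i
    using that A(1) c(4) by simp
  ultimately have "\<exists>W' A'. W' \<subseteq> W \<and> b ^ (p * t) * m \<le> card W' \<and>
     (\<forall>i\<in>{..<j}. A' i \<subseteq> A i \<and> card (A' i) = c \<and> complete_to W' (A' i))"
    by (intro common_trace[where s = b] finW) auto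
  then obtain W' A' where W': "W' \<subseteq> W" "b ^ (p * t) * m \<le> card W'"
     "\<forall>i\<in>{..<j}. A' i \<subseteq> A i \<and> card (A' i) = c \<and> complete_to W' (A' i)"
    by blast
  have "c ^ (p * t) * m \<le> b ^ (p * t) * m"
    using c by (intro mult_right_mono power_mono) auto
  then have "c ^ (p * t) * m \<le> card W'" using W'(2) by linarith
  then obtain I where I: "I \<subseteq> W'" "stable I" "card I = c"
    using large_has_stable[of W' c] W'(1) c(1) by (auto simp: W_def)
  show ?case
  proof (rule exI[of _ "A'(j := I)"], intro conjI allI impI)
    fix i assume i: "i < Suc j"
    have "A' i \<subseteq> V \<and> stable (A' i) \<and> card (A' i) = c" if "i < j"
      using W'(3) A(1) that stable_subset by (meson lessThan_iff subset_trans)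
    moreover have "I \<subseteq> V" using I(1) W'(1) by (auto simp: W_def)
    ultimately show "(A'(j := I)) i \<subseteq> V" "stable ((A'(j := I)) i)" "card ((A'(j := I)) i) = \<sigma> (Suc j)"
      using i I(2,3) unfolding c_def[symmetric] by (auto simp: less_Suc_eq)
  next
    fix i l assume il: "i < Suc j" "l < Suc j" "i \<noteq> l"
    have "complete_to I (A' i)" if "i < j" for i
      using that I(1) W'(3) complete_to_mono by blast
    moreover have "complete_to (A' i) (A' l)" if "i < j" "l < j"
      using complete_to_mono[of "A i" "A l" "A' i" "A' l"] that il(3) A(2) W'(3) by simp
    moreover have "complete_to (A' i) I" if "i < j" for i
      using that complete_to_sym calculation(1) by blast
    ultimately show "complete_to ((A'(j := I)) i) ((A'(j := I)) l)"
      using il by (simp add: less_Suc_eq) (elim disjE; simp)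
  qed
qed

text \<open>
  With \<open>p - 1\<close> sets at hand, a large \<open>W\<close> would complete a forbidden multipartite graph, so that
  \<open>cover_by_miss\<close> now leaves only few vertices uncovered.
\<close>

lemma nearly_covering_blowup:
  assumes \<sigma>: "\<And>j. j < p - 1 \<Longrightarrow> \<sigma> j = s * h * \<sigma> (Suc j)" "\<And>j. j \<le> p - 1 \<Longrightarrow> 1 \<le> \<sigma> j \<and> \<sigma> j \<le> b"
    and last: "\<sigma> (p - 1) = s * (h * t)"
    and s: "k \<le> s" and h: "2 * p * p \<le> h"
    and big: "2 * (2 ^ (b * p) * (b ^ (p * t) * m)) \<le> n"
  shows "\<exists>S. (\<forall>i<p-1. S i \<subseteq> V \<and> stable (S i) \<and> card (S i) = s) \<and>
             (\<forall>i<p-1. \<forall>l<p-1. i \<noteq> l \<longrightarrow> complete_to (S i) (S l)) \<and>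
             h * card (V - (\<Union>i<p-1. miss (S i))) \<le> h * (2 ^ (b * p) * m) + p * card V"
proof -
  obtain A where A: "\<forall>i<p-1. A i \<subseteq> V \<and> stable (A i) \<and> card (A i) = \<sigma> (p - 1)"
       "\<forall>i<p-1. \<forall>l<p-1. i \<noteq> l \<longrightarrow> complete_to (A i) (A l)"
    using blowup_exists[where \<sigma> = \<sigma> and j = "p - 1", OF \<sigma> s h big order_refl] by blast
  have h1: "1 \<le> h" using h pars by (cases h) auto
  define W where "W = {v \<in> V. \<forall>i<p-1. t \<le> card (nbrs v (A i))}"
  obtain S where S: "\<forall>i<p-1. S i \<subseteq> A i \<and> card (S i) = s"
      "h * card (V - W - (\<Union>i<p-1. miss (S i))) \<le> (p - 1) * card V"
    using cover_by_miss[of "p - 1" A s h t] A(1) last h1 pars unfolding W_def by auto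
  have finW: "finite W" using finite_V by (simp add: W_def)
  have W: "card W \<le> 2 ^ (b * p) * m"
  proof (rule ccontr)
    assume "\<not> ?thesis"
    moreover have "2 ^ (b * card {..<p-1}) * m \<le> 2 ^ (b * p) * m"
      by (intro mult_right_mono power_increasing) auto
    ultimately have "2 ^ (b * card {..<p-1}) * m \<le> card W" by linarith
    moreover have "finite (A i)" if "i < p - 1" for i using A(1) that finite_V finite_subset by blast
    moreover have "t \<le> card (nbrs w (A i))" if "w \<in> W" "i \<in> {..<p-1}" for w i
      using that by (simp add: W_def)
    moreover have "card (A i) \<le> b" if "i \<in> {..<p-1}" for i
      using that A(1) \<sigma>(2)[of "p - 1"] by simp
    ultimately have "\<exists>M T. M \<subseteq> W \<and> m \<le> card M \<and>
       (\<forall>i\<in>{..<p-1}. T i \<subseteq> A i \<and> card (T i) = t \<and> complete_to M (T i))"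
      using pars by (intro common_trace[where s = b] finW) auto
    then obtain M T where M: "M \<subseteq> W" "m \<le> card M"
       and T: "\<And>i. i < p - 1 \<Longrightarrow> T i \<subseteq> A i \<and> card (T i) = t \<and> complete_to M (T i)"
      by blast
    let ?T = "\<lambda>j. if j = p - 1 then M else T j"
    show False
    proof (rule no_copy_single[of 0 "p - 1" ?T])
      fix j assume "j < p"
      then have "T j \<subseteq> V" if "j \<noteq> p - 1"
      proof -
        have "j < p - 1" using \<open>j < p\<close> that by simp
        then show ?thesis using T[of j] A(1) by blast
      qed
      then show "?T j \<subseteq> V" using M(1) by (auto simp: W_def)
    next
      fix j l assume jl: "j < p" "l < p" "j \<noteq> l"
      then have "complete_to (T j) (T l)" if "j < p - 1" "l < p - 1"
        using complete_to_mono[of "A j" "A l" "T j" "T l"] that T A(2) by simp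
      moreover have "complete_to M (T l)" if "l < p - 1" using that T by blast
      moreover have "complete_to (T j) M" if "j < p - 1" using that T complete_to_sym by blast
      moreover have "j = p - 1 \<or> j < p - 1" "l = p - 1 \<or> l < p - 1" using jl by auto
      ultimately show "complete_to (?T j) (?T l)"
        using jl(3) by (simp; elim disjE; simp)
    qed (use pars M T in auto)
  qed
  let ?E = "V - (\<Union>i<p-1. miss (S i))"
  have "card ?E \<le> card (W \<union> (V - W - (\<Union>i<p-1. miss (S i))))"
    using finW finite_V by (intro card_mono) auto
  also have "\<dots> \<le> card W + card (V - W - (\<Union>i<p-1. miss (S i)))"
    by (rule card_Un_le)
  finally have "card ?E \<le> 2 ^ (b * p) * m + card (V - W - (\<Union>i<p-1. miss (S i)))"
    using W by linarith
  then have "h * card ?E \<le> h * (2 ^ (b * p) * m) + h * card (V - W - (\<Union>i<p-1. miss (S i)))"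
    by (metis add_mult_distrib2 mult_le_mono2)
  also have "\<dots> \<le> h * (2 ^ (b * p) * m) + p * card V"
    using S(2) mult_right_mono[of "p - 1" p "card V"] by linarith
  finally have "h * card ?E \<le> h * (2 ^ (b * p) * m) + p * card V" .
  moreover have "S i \<subseteq> V \<and> stable (S i) \<and> card (S i) = s" if "i < p - 1" for i
    using S(1) A(1) that stable_subset by (meson subset_trans)
  moreover have "complete_to (S i) (S l)" if "i < p - 1" "l < p - 1" "i \<noteq> l" for i l
    using complete_to_mono[of "A i" "A l" "S i" "S l"] that S(1) A(2) by simp
  ultimately show ?thesis by blast
qed

section \<open>An approximate partition into stable classes\<close>

text \<open>
  The other \<open>p - 2\<close> classes together have at most \<open>(p - 2) * (n - 1) = card V - n\<close> elements, so all but
  \<open>e\<close> of at least \<open>n\<close> vertices are covered by \<open>B i\<close> alone. Taking another class for \<open>X\<close> bounds the overlap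
  of two classes.
\<close>

lemma large_class:
  assumes B: "\<And>i. i < p - 1 \<Longrightarrow> B i \<subseteq> V \<and> card (B i) < n"
    and e: "card (V - (\<Union>i<p-1. B i)) \<le> e"
    and i: "i < p - 1" and X: "X \<inter> B i \<subseteq> (\<Union>l\<in>{..<p-1} - {i}. B l)"
  shows "n \<le> card (B i - X) + e"
proof -
  let ?W = "\<Union>l\<in>{..<p-1} - {i}. B l"
  have finB: "finite (B l)" if "l < p - 1" for l
    using B[OF that] finite_V finite_subset by blast
  have "card ?W \<le> (\<Sum>l\<in>{..<p-1} - {i}. card (B l))"
    by (intro card_UN_le) simp
  also have "\<dots> \<le> (\<Sum>l\<in>{..<p-1} - {i}. n - 1)"
    using B by (intro sum_mono) fastforce
  also have "\<dots> = (p - 2) * (n - 1)" using i by (simp add: numeral_2_eq_2)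
  finally have *: "card ?W \<le> (p - 2) * (n - 1)" .
  have "finite ?W" using finB by auto
  then have "card V \<le> card ((V - (\<Union>i<p-1. B i)) \<union> (B i - X) \<union> ?W)"
    using X finB[OF i] finite_V by (intro card_mono) auto
  also have "\<dots> \<le> card (V - (\<Union>i<p-1. B i)) + card (B i - X) + card ?W"
    by (meson add_mono card_Un_le le_trans order_refl)
  finally show ?thesis using * e card_V_eq by linarith
qed

text \<open>
  The classes \<open>miss (A i)\<close> have between \<open>n - e\<close> and \<open>n - 1\<close> elements. A \<open>k\<close>-set \<open>S \<subseteq> A j\<close> is also
  missed by fewer than \<open>n\<close> vertices, all of \<open>miss (A j)\<close> among them, so at most \<open>e\<close> vertices outside that
  class miss \<open>S\<close>. Summing over all \<open>S\<close>, almost every vertex outside of \<open>miss (A j)\<close> has fewer than \<open>k\<close>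
  non-neighbours in \<open>A j\<close>. A vertex \<open>x\<close> of \<open>C i\<close> with many neighbours in \<open>C i\<close> would then be, with a set
  of such neighbours and common neighbours in the \<open>A j\<close>, a forbidden multipartite graph.
\<close>

lemma stability_core:
  assumes A: "\<And>i. i < p - 1 \<Longrightarrow> A i \<subseteq> V \<and> stable (A i) \<and> card (A i) = s"
    and compl: "\<And>i l. i < p - 1 \<Longrightarrow> l < p - 1 \<Longrightarrow> i \<noteq> l \<Longrightarrow> complete_to (A i) (A l)"
    and s: "t + 2 * k \<le> s"
    and e: "e = card (V - (\<Union>i<p-1. miss (A i)))"
  defines "D \<equiv> (\<lambda>j. {v \<in> V. k \<le> card {y \<in> A j. \<not> R v y}})"
  defines "C \<equiv> (\<lambda>i. {v \<in> miss (A i). \<forall>j<p-1. j \<noteq> i \<longrightarrow> v \<notin> D j})"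
  shows "\<And>i. i < p - 1 \<Longrightarrow> card (C i) < n"
    and "card (V - (\<Union>i<p-1. C i)) \<le> (1 + p * s ^ k + p * p) * e"
    and "\<And>i j. i < p - 1 \<Longrightarrow> j < p - 1 \<Longrightarrow> i \<noteq> j \<Longrightarrow> C i \<inter> C j = {}"
    and "\<And>i x. i < p - 1 \<Longrightarrow> x \<in> C i \<Longrightarrow> card (nbrs x (C i)) \<le> 2 ^ (s * p) * m"
proof -
  have finA: "finite (A i)" if "i < p - 1" for i
    using A that finite_V finite_subset by blast
  have B: "card (miss (A i)) < n" if "i < p - 1" for i
    using A[OF that] s by (intro card_miss) auto
  show "card (C i) < n" if "i < p - 1" for i
  proof -
    have "card (C i) \<le> card (miss (A i))" by (intro card_mono) (auto simp: C_def)
    then show ?thesis using B[OF that] by linarith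
  qed
  let ?U = "\<Union>i<p-1. miss (A i)"
  have others: "n - e \<le> card (miss (A i) - X)"
    if i: "i < p - 1" and X: "X \<inter> miss (A i) \<subseteq> (\<Union>l\<in>{..<p-1} - {i}. miss (A l))" for i X
    using large_class[of "\<lambda>i. miss (A i)" e i X] B i X unfolding e by (simp add: miss_def)
  have overlap: "card (miss (A i) \<inter> miss (A j)) \<le> e" if "i < p - 1" "j < p - 1" "i \<noteq> j" for i j
  proof -
    have "n - e \<le> card (miss (A i) - miss (A j))"
      using that by (intro others) auto
    also have "\<dots> = card (miss (A i)) - card (miss (A i) \<inter> miss (A j))"
      by (simp add: card_Diff_subset_Int)
    finally have "n - e \<le> card (miss (A i)) - card (miss (A i) \<inter> miss (A j))" .
    moreover have "card (miss (A i) \<inter> miss (A j)) \<le> card (miss (A i))"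
      by (intro card_mono) auto
    ultimately show ?thesis using B[OF that(1)] by linarith
  qed
  have DB: "card (D j - miss (A j)) \<le> s ^ k * e" if j: "j < p - 1" for j
  proof -
    let ?K = "{S. S \<subseteq> A j \<and> card S = k}"
    have sub: "D j - miss (A j) \<subseteq> (\<Union>S\<in>?K. miss S - miss (A j))"
    proof
      fix v assume v: "v \<in> D j - miss (A j)"
      then obtain S where "S \<subseteq> {y \<in> A j. \<not> R v y}" "card S = k"
        using obtain_subset_with_card_n unfolding D_def by blast
      then show "v \<in> (\<Union>S\<in>?K. miss S - miss (A j))"
        using v by (auto simp: miss_def D_def)
    qed
    have one: "card (miss S - miss (A j)) \<le> e" if S: "S \<in> ?K" for S
    proof -
      have "card (miss S) < n"
        using S A[OF j] stable_subset by (intro card_miss) auto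
      moreover have "miss (A j) \<subseteq> miss S" using S by (intro miss_antimono) auto
      moreover have "n - e \<le> card (miss (A j))" using others[of j "{}"] j by simp
      ultimately show ?thesis by (simp add: card_Diff_subset)
    qed
    have finK: "finite ?K" using finA[OF j] by auto
    have "card (D j - miss (A j)) \<le> card (\<Union>S\<in>?K. miss S - miss (A j))"
      using finK by (intro card_mono[OF _ sub]) auto
    also have "\<dots> \<le> (\<Sum>S\<in>?K. card (miss S - miss (A j)))"
      using finK by (rule card_UN_le)
    also have "\<dots> \<le> (\<Sum>S\<in>?K. e)" using one by (intro sum_mono)
    also have "\<dots> = (s choose k) * e" using n_subsets[OF finA[OF j], of k] A[OF j] by simp
    also have "\<dots> \<le> s ^ k * e"
      using s by (intro mult_right_mono binomial_le_pow) auto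
    finally show ?thesis .
  qed
  show "card (V - (\<Union>i<p-1. C i)) \<le> (1 + p * s ^ k + p * p) * e"
  proof -
    let ?P = "{(i, j). i < p - 1 \<and> j < p - 1 \<and> i \<noteq> j}"
    have P: "?P \<subseteq> {..<p-1} \<times> {..<p-1}" by auto
    have finP: "finite ?P" using P by (rule finite_subset) auto
    have cardP: "card ?P \<le> p * p"
    proof -
      have "card ?P \<le> card ({..<p-1} \<times> {..<p-1})" using P by (intro card_mono) auto
      also have "\<dots> = (p - 1) * (p - 1)" by (simp only: card_cartesian_product card_lessThan)
      also have "\<dots> \<le> p * p" by (intro mult_mono) auto
      finally show ?thesis .
    qed
    have "V - (\<Union>i<p-1. C i) \<subseteq> (V - ?U) \<union> (\<Union>j<p-1. D j - miss (A j)) \<union>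
       (\<Union>(i,j)\<in>?P. miss (A i) \<inter> miss (A j))"
      by (fastforce simp: C_def)
    then have "card (V - (\<Union>i<p-1. C i)) \<le> card ((V - ?U) \<union> (\<Union>j<p-1. D j - miss (A j)) \<union>
       (\<Union>(i,j)\<in>?P. miss (A i) \<inter> miss (A j)))"
      using finite_V finP by (intro card_mono) (auto simp: D_def)
    also have "\<dots> \<le> e + card (\<Union>j<p-1. D j - miss (A j)) + card (\<Union>(i,j)\<in>?P. miss (A i) \<inter> miss (A j))"
      unfolding e by (meson add_mono card_Un_le le_trans order_refl)
    also have "card (\<Union>j<p-1. D j - miss (A j)) \<le> (\<Sum>j<p-1. card (D j - miss (A j)))"
      by (intro card_UN_le) simp
    also have "\<dots> \<le> (\<Sum>j<p-1. s ^ k * e)" using DB by (intro sum_mono) auto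
    also have "\<dots> \<le> p * s ^ k * e" by simp
    also have "card (\<Union>(i,j)\<in>?P. miss (A i) \<inter> miss (A j)) \<le> (\<Sum>ij\<in>?P. card (case ij of (i,j) \<Rightarrow> miss (A i) \<inter> miss (A j)))"
      by (intro card_UN_le finP)
    also have "\<dots> \<le> (\<Sum>ij\<in>?P. e)" using overlap by (intro sum_mono) auto
    also have "\<dots> \<le> p * p * e" using mult_right_mono[OF cardP, of e] by simp
    finally show ?thesis by (simp add: algebra_simps)
  qed
  show "C i \<inter> C j = {}" if "i < p - 1" "j < p - 1" "i \<noteq> j" for i j
  proof -
    have "v \<in> D j" if "v \<in> miss (A j)" for v
    proof -
      have "{y \<in> A j. \<not> R v y} = A j" "v \<in> V" using that by (auto simp: miss_def)
      then show ?thesis using A[OF \<open>j < p - 1\<close>] s by (simp add: D_def)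
    qed
    then show ?thesis using that by (auto simp: C_def)
  qed
  show "card (nbrs x (C i)) \<le> 2 ^ (s * p) * m" if i: "i < p - 1" and x: "x \<in> C i" for i x
  proof (rule ccontr)
    assume "\<not> ?thesis"
    then have big: "2 ^ (s * p) * m \<le> card (nbrs x (C i))" by simp
    let ?J = "{..<p-1} - {i}"
    have nonnbrs: "card {y \<in> A j. \<not> R v y} < k" if "v \<in> C i" "j \<in> ?J" for v j
      using that by (auto simp: C_def D_def miss_def not_le)
    have deg: "t \<le> card (nbrs w (nbrs x (A j)))" if w: "w \<in> nbrs x (C i)" and j: "j \<in> ?J" for w j
    proof -
      have "w \<in> C i" using w by (simp add: nbrs_def)
      have "card (A j) \<le> card (nbrs w (nbrs x (A j)) \<union> {y \<in> A j. \<not> R w y} \<union> {y \<in> A j. \<not> R x y})"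
        using finA j by (intro card_mono) (auto simp: nbrs_def)
      also have "\<dots> \<le> card (nbrs w (nbrs x (A j))) + card {y \<in> A j. \<not> R w y} + card {y \<in> A j. \<not> R x y}"
        by (meson add_mono card_Un_le le_trans order_refl)
      finally show ?thesis
        using nonnbrs[OF \<open>w \<in> C i\<close> j] nonnbrs[OF x j] A[of j] j s by simp
    qed
    have cardJ: "card ?J \<le> p" using i by simp
    have CV: "C l \<subseteq> V" for l by (auto simp: C_def miss_def)
    have "2 ^ (s * card ?J) * m \<le> 2 ^ (s * p) * m"
      using cardJ by (intro mult_right_mono power_increasing mult_left_mono) auto
    then have "2 ^ (s * card ?J) * m \<le> card (nbrs x (C i))" using big by linarith
    moreover have "card (nbrs x (A j)) \<le> s" if "j \<in> ?J" for j
      using that A[of j] card_mono[OF finA[of j] nbrs_subset[of x "A j"]] by simp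
    ultimately have "\<exists>M T. M \<subseteq> nbrs x (C i) \<and> m \<le> card M \<and>
        (\<forall>j\<in>?J. T j \<subseteq> nbrs x (A j) \<and> card (T j) = t \<and> complete_to M (T j))"
      using deg finA pars finite_subset[OF CV finite_V]
      by (intro common_trace[where s = s]) auto
    then obtain M T where M: "M \<subseteq> nbrs x (C i)" "m \<le> card M"
        and T: "\<And>j. j \<in> ?J \<Longrightarrow> T j \<subseteq> nbrs x (A j) \<and> card (T j) = t \<and> complete_to M (T j)"
      by blast
    let ?T = "\<lambda>j. if j = p - 1 then {x} else if j = i then M else T j"
    have xM: "complete_to {x} M" using M by (auto simp: complete_to_def nbrs_def)
    have xT: "complete_to {x} (T j)" if "j \<in> ?J" for j
      using T[OF that] by (auto simp: complete_to_def nbrs_def)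
    have TT: "complete_to (T j) (T l)" if "j \<in> ?J" "l \<in> ?J" "j \<noteq> l" for j l
      using T[OF that(1)] T[OF that(2)] compl[of j l] that nbrs_subset complete_to_mono
      by (meson Diff_iff lessThan_iff order_trans)
    show False
    proof (rule no_copy_single[of "p - 1" i ?T])
      fix j assume "j < p"
      have "T j \<subseteq> V" if "j \<noteq> p - 1" "j \<noteq> i"
      proof -
        have "j < p - 1" using \<open>j < p\<close> that by simp
        then show ?thesis using T[of j] A[of j] nbrs_subset[of x "A j"] that by blast
      qed
      moreover have "M \<subseteq> V" using M(1) CV nbrs_subset by blast
      ultimately show "?T j \<subseteq> V" using x CV by auto
    next
      fix j l assume jl: "j < p" "l < p" "j \<noteq> l"
      have cases: "j = p - 1 \<or> j = i \<or> j \<in> ?J" "l = p - 1 \<or> l = i \<or> l \<in> ?J"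
        using jl by auto
      have "complete_to M {x}" "\<And>j. j \<in> ?J \<Longrightarrow> complete_to (T j) {x}"
          "\<And>j. j \<in> ?J \<Longrightarrow> complete_to M (T j)" "\<And>j. j \<in> ?J \<Longrightarrow> complete_to (T j) M"
        using xM xT T complete_to_sym by blast+
      then show "complete_to (?T j) (?T l)"
        using xM xT TT jl(3) i by (rule_tac disjE[OF cases(1)]; rule_tac disjE[OF cases(2)]) auto
    qed (use i pars M T in auto)
  qed
qed

text \<open>
  Stable \<open>k\<close>-sets \<open>S\<close> inside \<open>C i\<close> are missed by almost all of \<open>C i\<close>, hence by few vertices elsewhere.
  If many vertices of \<open>C i\<close> had more than \<open>g\<close> non-neighbours in \<open>C j\<close>, then a stable \<open>q\<close>-set \<open>I\<close> of
  such vertices exists, and counting the non-adjacent pairs between \<open>I\<close> and \<open>C j\<close> yields many vertices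
  with at least \<open>k\<close> non-neighbours in \<open>I\<close>.
\<close>

lemma few_exceptional:
  assumes C: "\<And>i. i < p - 1 \<Longrightarrow> C i \<subseteq> V \<and> card (C i) < n"
    and disj: "\<And>i j. i < p - 1 \<Longrightarrow> j < p - 1 \<Longrightarrow> i \<noteq> j \<Longrightarrow> C i \<inter> C j = {}"
    and f: "card (V - (\<Union>i<p-1. C i)) \<le> f"
    and d: "\<And>i x. i < p - 1 \<Longrightarrow> x \<in> C i \<Longrightarrow> card (nbrs x (C i)) \<le> d"
    and num: "q ^ Suc k * (f + k * d) + k * card V < q * g"
    and ij: "i < p - 1" "j < p - 1" "i \<noteq> j"
  shows "card {x \<in> C i. g < card {y \<in> C j. \<not> R x y}} \<le> q * (d + 1)"
proof (rule ccontr)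
  let ?D = "{x \<in> C i. g < card {y \<in> C j. \<not> R x y}}"
  assume "\<not> ?thesis"
  then have big: "q * (d + 1) \<le> card ?D" by simp
  have fin: "finite (C i)" "finite (C j)" using C ij finite_V finite_subset by blast+
  have "card (nbrs x ?D) \<le> d" if "x \<in> ?D" for x
  proof -
    have "card (nbrs x ?D) \<le> card (nbrs x (C i))"
      using fin by (intro card_mono) (auto simp: nbrs_def)
    then show ?thesis using d[OF ij(1), of x] that by simp
  qed
  then obtain I where I: "I \<subseteq> ?D" "stable I" "card I = q"
    using stable_if_bounded_degree[of ?D d q] big fin by auto
  have finI: "finite I" using I(1) fin finite_subset[of I "C i"] by auto
  define Z where "Z = {y \<in> C j. k \<le> card {x \<in> I. \<not> R x y}}"
  let ?K = "{S. S \<subseteq> I \<and> card S = k}"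
  have one: "card (miss S - C i) \<le> f + k * d" if S: "S \<in> ?K" for S
  proof -
    have SC: "S \<subseteq> C i" using S I(1) by auto
    have finS: "finite S" using SC fin finite_subset by blast
    have "card (miss S) < n"
      using S SC C[OF ij(1)] I(2) stable_subset by (intro no_book) auto
    moreover have "n \<le> card (C i) + f"
      using large_class[OF C f ij(1), of "{}"] by simp
    moreover have "card (C i) \<le> card (miss S \<inter> C i) + k * d"
    proof -
      have "C i \<subseteq> (miss S \<inter> C i) \<union> (\<Union>x\<in>S. nbrs x (C i))"
        using C[OF ij(1)] sym by (auto simp: miss_def nbrs_def)
      then have "card (C i) \<le> card ((miss S \<inter> C i) \<union> (\<Union>x\<in>S. nbrs x (C i)))"
        using fin finS by (intro card_mono) auto
      also have "\<dots> \<le> card (miss S \<inter> C i) + card (\<Union>x\<in>S. nbrs x (C i))"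
        by (rule card_Un_le)
      also have "card (\<Union>x\<in>S. nbrs x (C i)) \<le> (\<Sum>x\<in>S. card (nbrs x (C i)))"
        using finS by (rule card_UN_le)
      also have "\<dots> \<le> (\<Sum>x\<in>S. d)" using d[OF ij(1)] SC by (intro sum_mono) auto
      also have "\<dots> = k * d" using S by simp
      finally show ?thesis by simp
    qed
    moreover have "card (miss S) = card (miss S \<inter> C i) + card (miss S - C i)"
      using card_Un_disjoint[of "miss S \<inter> C i" "miss S - C i"] by (simp add: Int_Diff_Un Int_Diff_disjoint)
    ultimately show ?thesis by linarith
  qed
  have "Z \<subseteq> (\<Union>S\<in>?K. miss S - C i)"
  proof
    fix y assume y: "y \<in> Z"
    then obtain S where "S \<subseteq> {x \<in> I. \<not> R x y}" "card S = k"
      using obtain_subset_with_card_n unfolding Z_def by blast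
    moreover have "y \<in> V" "y \<notin> C i" using y C[OF ij(2)] disj[OF ij] by (auto simp: Z_def)
    ultimately show "y \<in> (\<Union>S\<in>?K. miss S - C i)"
      using sym by (auto simp: miss_def)
  qed
  moreover have finK: "finite ?K" using finI by auto
  ultimately have "card Z \<le> card (\<Union>S\<in>?K. miss S - C i)"
    by (intro card_mono) auto
  also have "\<dots> \<le> (\<Sum>S\<in>?K. card (miss S - C i))"
    using finK by (rule card_UN_le)
  also have "\<dots> \<le> (\<Sum>S\<in>?K. f + k * d)" using one by (intro sum_mono)
  also have "\<dots> = (q choose k) * (f + k * d)" using n_subsets[OF finI, of k] I(3) by simp
  also have "\<dots> \<le> q ^ k * (f + k * d)"
    by (cases "k \<le> q") (auto intro: mult_right_mono binomial_le_pow simp: binomial_eq_0)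
  finally have Z: "card Z \<le> q ^ k * (f + k * d)" .
  have "q * g = (\<Sum>x\<in>I. g)" using I(3) by simp
  also have "\<dots> \<le> (\<Sum>x\<in>I. card {y \<in> C j. \<not> R x y})"
    using I(1) by (intro sum_mono) auto
  also have "\<dots> = (\<Sum>y\<in>C j. card {x \<in> I. \<not> R x y})"
    using finI fin by (intro sum_card_swap)
  also have "\<dots> \<le> (\<Sum>y\<in>C j. k + (if y \<in> Z then q else 0))"
  proof (intro sum_mono)
    fix y assume y: "y \<in> C j"
    have "card {x \<in> I. \<not> R x y} \<le> q" using card_mono[OF finI, of "{x \<in> I. \<not> R x y}"] I(3) by auto
    then show "card {x \<in> I. \<not> R x y} \<le> k + (if y \<in> Z then q else 0)"
      using y by (auto simp: Z_def)
  qed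
  also have "\<dots> = k * card (C j) + q * card Z"
  proof -
    have "{y \<in> C j. y \<in> Z} = Z" by (auto simp: Z_def)
    then show ?thesis using fin by (simp add: sum.distrib sum.If_cases Int_def)
  qed
  also have "\<dots> \<le> k * card V + q * (q ^ k * (f + k * d))"
    using Z C[OF ij(2)] finite_V by (intro add_mono mult_left_mono card_mono) auto
  finally show False using num by simp
qed

section \<open>From the approximate partition to a contradiction\<close>

text \<open>
  Any \<open>t\<close> vertices of one class are adjacent to all but \<open>t * g\<close> vertices of each other class, so the parts
  can be chosen one after the other, shrinking the remaining candidate sets by \<open>t * g\<close> each time. The part
  indexed by \<open>z\<close> is what is left of \<open>X z\<close> at the end.
\<close>

lemma greedy_blowup:
  assumes near: "\<And>i j x. i < p - 1 \<Longrightarrow> j < p - 1 \<Longrightarrow> i \<noteq> j \<Longrightarrow> x \<in> C i \<Longrightarrow> card {y \<in> C j. \<not> R x y} \<le> g"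
    and C: "\<And>i. i < p - 1 \<Longrightarrow> C i \<subseteq> V"
    and J: "finite J" "J \<subseteq> {..<p-1}" and z: "z < p - 1" "z \<notin> J"
    and X: "\<And>i. i \<in> insert z J \<Longrightarrow> X i \<subseteq> C i \<and> b + t * g * card J \<le> card (X i)" and b: "t \<le> b"
  shows "\<exists>T. (\<forall>i\<in>insert z J. T i \<subseteq> X i) \<and> (\<forall>i\<in>J. card (T i) = t) \<and> b \<le> card (T z) \<and>
             (\<forall>i\<in>insert z J. \<forall>j\<in>insert z J. i \<noteq> j \<longrightarrow> complete_to (T i) (T j))"
  using J z X
proof (induction J arbitrary: X rule: finite_induct)
  case empty
  then show ?case by (intro exI[of _ X]) simp
next
  case (insert j J)
  have "t \<le> card (X j)" using insert.prems(4)[of j] b by simp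
  then obtain S where S: "S \<subseteq> X j" "card S = t"
    using obtain_subset_with_card_n by metis
  define Y where "Y = (\<lambda>i. {y \<in> X i. \<forall>x\<in>S. R x y})"
  have j: "j < p - 1" using insert.prems(1) by simp
  have SC: "S \<subseteq> C j" using S(1) insert.prems(4)[of j] by auto
  have finC: "finite (C i)" if "i < p - 1" for i using C[OF that] finite_V finite_subset by blast
  have finS: "finite S" using SC finC[OF j] finite_subset by blast
  have Y: "Y i \<subseteq> C i \<and> b + t * g * card J \<le> card (Y i)" if i: "i \<in> insert z J" for i
  proof -
    have i': "i < p - 1" "i \<noteq> j" using i insert.hyps insert.prems(1-3) by auto
    have Xi: "X i \<subseteq> C i" "b + t * g * card (insert j J) \<le> card (X i)"
      using insert.prems(4)[of i] i by auto
    then have finX: "finite (X i)" using finC[OF i'(1)] finite_subset by blast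
    have "card (X i) \<le> card (Y i \<union> (\<Union>x\<in>S. {y \<in> C i. \<not> R x y}))"
      using finX finS finC[OF i'(1)] Xi(1) by (intro card_mono) (auto simp: Y_def)
    also have "\<dots> \<le> card (Y i) + card (\<Union>x\<in>S. {y \<in> C i. \<not> R x y})"
      by (rule card_Un_le)
    also have "card (\<Union>x\<in>S. {y \<in> C i. \<not> R x y}) \<le> (\<Sum>x\<in>S. card {y \<in> C i. \<not> R x y})"
      using finS by (rule card_UN_le)
    also have "\<dots> \<le> (\<Sum>x\<in>S. g)"
      using near[OF j i'(1)] i'(2) SC by (intro sum_mono) auto
    also have "\<dots> = t * g" using S(2) by simp
    finally have "card (X i) \<le> card (Y i) + t * g" by simp
    moreover have "t * g * card (insert j J) = t * g * card J + t * g"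
      using insert.hyps by simp
    ultimately show ?thesis using Xi by (auto simp: Y_def)
  qed
  obtain T where T: "\<forall>i\<in>insert z J. T i \<subseteq> Y i" "\<forall>i\<in>J. card (T i) = t" "b \<le> card (T z)"
       "\<forall>i\<in>insert z J. \<forall>l\<in>insert z J. i \<noteq> l \<longrightarrow> complete_to (T i) (T l)"
    using insert.IH[of Y] Y insert.prems(1-3) by auto
  have ST: "complete_to S (T i)" if "i \<in> insert z J" for i
    using T(1) that by (auto simp: complete_to_def Y_def)
  have jn: "j \<notin> insert z J" using insert.hyps insert.prems(3) by auto
  show ?case
  proof (rule exI[of _ "T(j := S)"], intro conjI ballI impI)
    fix i assume i: "i \<in> insert z (insert j J)"
    show "(T(j := S)) i \<subseteq> X i"
      using i T(1) S(1) by (auto simp: Y_def)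
  next
    fix i assume "i \<in> insert j J"
    then show "card ((T(j := S)) i) = t" using T(2) S(2) by auto
  next
    show "b \<le> card ((T(j := S)) z)" using T(3) jn by auto
  next
    fix i l assume il: "i \<in> insert z (insert j J)" "l \<in> insert z (insert j J)" "i \<noteq> l"
    show "complete_to ((T(j := S)) i) ((T(j := S)) l)"
    proof (cases "i = j"; cases "l = j")
      assume "i = j" "l \<noteq> j"
      then show ?thesis using ST il by auto
    next
      assume "i \<noteq> j" "l = j"
      then show ?thesis using ST[of i] il complete_to_sym by auto
    next
      assume "i \<noteq> j" "l \<noteq> j"
      then show ?thesis using T(4) il by auto
    qed (use il in simp)
  qed
qed

text \<open>
  The final count with the sets \<open>U\<^sub>j\<close> of vertices with few neighbours in \<open>C\<^sub>j\<close>. The set \<open>E\<close> of vertices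
  counted more than once need not be small; the argument works since the excess of \<open>|U\<^sub>j|\<close> over
  \<open>n - 1\<close> is only a fraction \<open>1 / p\<close> of \<open>|E|\<close>.
\<close>

lemma no_stable_partition:
  assumes C: "\<And>i. i < p - 1 \<Longrightarrow> C i \<subseteq> V"
    and near: "\<And>i j x. i < p - 1 \<Longrightarrow> j < p - 1 \<Longrightarrow> i \<noteq> j \<Longrightarrow> x \<in> C i \<Longrightarrow> card {y \<in> C j. \<not> R x y} \<le> g"
    and d: "\<And>i x. i < p - 1 \<Longrightarrow> x \<in> C i \<Longrightarrow> card (nbrs x (C i)) < b + t * g * p"
    and b: "t \<le> b" "m \<le> b"
    and big: "\<And>i. i < p - 1 \<Longrightarrow> p * k * (b + t * g * p + g) + g \<le> card (C i)"
  shows False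
proof -
  define G where "G = b + t * g * p + g"
  define U where "U = (\<lambda>j. {v \<in> V. card (nbrs v (C j)) < G})"
  have G1: "1 \<le> G" using b pars by (simp add: G_def)
  have finC: "finite (C i)" if "i < p - 1" for i using C[OF that] finite_V finite_subset by blast
  have GC: "G + g \<le> card (C i)" if "i < p - 1" for i
  proof -
    have "1 * G \<le> p * k * G" using pars by (intro mult_right_mono) auto
    moreover have "p * k * G + g \<le> card (C i)" unfolding G_def using big[OF that] .
    ultimately show ?thesis by linarith
  qed
  have pJ: "t * g * card J \<le> t * g * p" if "J \<subseteq> {..<p-1}" for J
  proof -
    have "card J \<le> p - 1" using card_mono[OF _ that] by simp
    then show ?thesis by (intro mult_left_mono) auto
  qed
  \<comment> \<open>A vertex with many neighbours in all classes would be the part of size one next to \<open>p - 1\<close>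
    parts found in its neighbourhood.\<close>
  have cover: "\<exists>j<p-1. v \<in> U j" if v: "v \<in> V" for v
  proof (rule ccontr)
    assume *: "\<not> ?thesis"
    let ?J = "{..<p-2}"
    have "\<exists>T. (\<forall>i\<in>insert (p-2) ?J. T i \<subseteq> nbrs v (C i)) \<and> (\<forall>i\<in>?J. card (T i) = t) \<and> b \<le> card (T (p-2)) \<and>
             (\<forall>i\<in>insert (p-2) ?J. \<forall>j\<in>insert (p-2) ?J. i \<noteq> j \<longrightarrow> complete_to (T i) (T j))"
    proof (rule greedy_blowup[OF near C])
      fix i assume "i \<in> insert (p - 2) ?J"
      then have "i < p - 1" using pars by auto
      then have "\<not> card (nbrs v (C i)) < G" using * v unfolding U_def by blast
      then have "G \<le> card (nbrs v (C i))" by simp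
      moreover have "b + t * g * p \<le> G" by (simp add: G_def)
      moreover have "t * g * card ?J \<le> t * g * p" by (intro pJ) auto
      ultimately show "nbrs v (C i) \<subseteq> C i \<and> b + t * g * card ?J \<le> card (nbrs v (C i))"
        using nbrs_subset by (meson add_left_mono order_trans)
    qed (use pars b in auto)
    moreover have "insert (p - 2) ?J = {..<p-1}" using pars by auto
    ultimately have "\<exists>T. (\<forall>i\<in>{..<p-1}. T i \<subseteq> nbrs v (C i)) \<and> (\<forall>i\<in>?J. card (T i) = t) \<and> b \<le> card (T (p-2)) \<and>
             (\<forall>i\<in>{..<p-1}. \<forall>j\<in>{..<p-1}. i \<noteq> j \<longrightarrow> complete_to (T i) (T j))"
      by (simp only:)
    then obtain T where T: "\<forall>i<p-1. T i \<subseteq> nbrs v (C i)" "\<forall>i<p-2. card (T i) = t" "b \<le> card (T (p-2))"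
       "\<forall>i<p-1. \<forall>j<p-1. i \<noteq> j \<longrightarrow> complete_to (T i) (T j)"
      unfolding lessThan_iff Ball_def by blast
    have vT: "complete_to {v} (T i)" if "i < p - 1" for i
      using T(1) that by (auto simp: complete_to_def nbrs_def)
    have Tv: "complete_to (T i) {v}" if "i < p - 1" for i
      using vT[OF that] by (rule complete_to_sym)
    show False
    proof (rule no_copy_single[of "p - 1" "p - 2" "T(p - 1 := {v})"])
      fix i assume "i < p"
      then have "i = p - 1 \<or> i < p - 1" by auto
      then show "(T(p - 1 := {v})) i \<subseteq> V"
        using v T(1) C[of i] nbrs_subset[of v "C i"] by auto
    next
      fix i j assume ij: "i < p" "j < p" "i \<noteq> j"
      then have "i = p - 1 \<or> i < p - 1" "j = p - 1 \<or> j < p - 1" by auto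
      then show "complete_to ((T(p - 1 := {v})) i) ((T(p - 1 := {v})) j)"
        using ij(3) vT Tv T(4) by auto
    next
      fix i assume "i < p" "i \<notin> {p - 1, p - 2}"
      then have "i < p - 2" "i \<noteq> p - 1" by auto
      then show "t \<le> card ((T(p - 1 := {v})) i)" using T(2) by simp
    qed (use pars T b in auto)
  qed
  \<comment> \<open>Otherwise \<open>x\<close> and \<open>y\<close> are the two parts of size one, and the other parts are found in the common
    neighbourhood of \<open>x\<close> and \<open>y\<close> in the classes other than \<open>C j\<close>.\<close>
  have edge: "\<exists>i<p-1. i \<noteq> j \<and> y \<in> U i"
    if j: "j < p - 1" and x: "x \<in> C j" and y: "y \<in> V" and xy: "R x y" for x y j
  proof (rule ccontr)
    assume *: "\<not> ?thesis"
    have "card {..<p-1} > card {j}" using pars by simp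
    then obtain z where z: "z < p - 1" "z \<noteq> j"
      by (metis card_mono finite.emptyI finite.insertI insert_iff leD lessThan_iff subsetI)
    let ?J = "{..<p-1} - {j, z}"
    have ins: "insert z ?J = {..<p-1} - {j}" using z by auto
    have "\<exists>T. (\<forall>i\<in>insert z ?J. T i \<subseteq> nbrs x (nbrs y (C i))) \<and> (\<forall>i\<in>?J. card (T i) = t) \<and> b \<le> card (T z) \<and>
             (\<forall>i\<in>insert z ?J. \<forall>j\<in>insert z ?J. i \<noteq> j \<longrightarrow> complete_to (T i) (T j))"
    proof (rule greedy_blowup[OF near C])
      fix i assume "i \<in> insert z ?J"
      then have i: "i < p - 1" "i \<noteq> j" unfolding ins by auto
      then have "\<not> card (nbrs y (C i)) < G" using * y unfolding U_def by blast
      then have "G \<le> card (nbrs y (C i))" by simp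
      also have "\<dots> = card (nbrs x (nbrs y (C i))) + card {w \<in> nbrs y (C i). \<not> R x w}"
        using finC[OF i(1)] by (intro card_nbrs_compl[symmetric]) simp
      also have "card {w \<in> nbrs y (C i). \<not> R x w} \<le> card {w \<in> C i. \<not> R x w}"
        using finC[OF i(1)] by (intro card_mono) (auto simp: nbrs_def)
      also have "\<dots> \<le> g" using near[OF j i(1)] i(2) x by auto
      finally have "b + t * g * p \<le> card (nbrs x (nbrs y (C i)))" by (simp add: G_def)
      moreover have "nbrs x (nbrs y (C i)) \<subseteq> C i" using nbrs_subset by blast
      moreover have "t * g * card ?J \<le> t * g * p" by (intro pJ) auto
      ultimately show "nbrs x (nbrs y (C i)) \<subseteq> C i \<and> b + t * g * card ?J \<le> card (nbrs x (nbrs y (C i)))"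
        by linarith
    qed (use z b in auto)
    then obtain T where T: "\<forall>i\<in>{..<p-1} - {j}. T i \<subseteq> nbrs x (nbrs y (C i))" "\<forall>i\<in>?J. card (T i) = t"
       "b \<le> card (T z)" "\<forall>i\<in>{..<p-1} - {j}. \<forall>l\<in>{..<p-1} - {j}. i \<noteq> l \<longrightarrow> complete_to (T i) (T l)"
      unfolding ins by blast
    let ?T = "T(j := {x}, p - 1 := {y})"
    have xT: "complete_to {x} (T i)" "complete_to {y} (T i)" if "i \<in> {..<p-1} - {j}" for i
      using T(1) that by (auto simp: complete_to_def nbrs_def)
    have Tx: "complete_to (T i) {x}" "complete_to (T i) {y}" if "i \<in> {..<p-1} - {j}" for i
      using xT[OF that] complete_to_sym by blast+
    have xy': "complete_to {x} {y}" "complete_to {y} {x}"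
      using xy sym by (auto simp: complete_to_def)
    show False
    proof (rule no_copy[of j "p - 1" z ?T])
      fix i assume "i < p"
      then have "i = p - 1 \<or> i = j \<or> i \<in> {..<p-1} - {j}" by auto
      moreover have "T i \<subseteq> V" if "i \<in> {..<p-1} - {j}"
        using T(1) that C[of i] nbrs_subset by blast
      ultimately show "?T i \<subseteq> V" using x y C[OF j] j by auto
    next
      fix i l assume il: "i < p" "l < p" "i \<noteq> l"
      then have "i = p - 1 \<or> i = j \<or> i \<in> {..<p-1} - {j}" "l = p - 1 \<or> l = j \<or> l \<in> {..<p-1} - {j}" by auto
      then show "complete_to (?T i) (?T l)"
        using il(3) xT Tx xy' T(4) j by auto
    next
      fix i assume "i < p" "i \<notin> {j, p - 1, z}"
      then have "i \<in> ?J" by auto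
      then show "t \<le> card (?T i)" using T(2) by auto
    qed (use j z T b in auto)
  qed
  have C_U: "x \<notin> U i" if "i < p - 1" "j < p - 1" "i \<noteq> j" "x \<in> C j" for x i j
  proof -
    have "card (nbrs x (C i)) + g \<ge> card (C i)"
      using card_nbrs_compl[OF finC[OF that(1)], of x] near[OF that(2,1)] that by fastforce
    then show ?thesis using GC[OF that(1)] by (simp add: U_def)
  qed
  have stable_C: "stable (C j)" if j: "j < p - 1" for j
  proof -
    have "\<not> R x y" if "x \<in> C j" "y \<in> C j" for x y
      using edge[OF j that(1), of y] C_U[of _ j y] C[OF j] that j by blast
    then show ?thesis by (simp add: stable_def)
  qed
  define E where "E = {v \<in> V. \<exists>i<p-1. \<exists>j<p-1. i \<noteq> j \<and> v \<in> U i \<and> v \<in> U j}"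
  have finE: "finite E" "finite (U j)" for j using finite_V by (auto simp: E_def U_def)
  have size: "p * card (U j) \<le> p * (n - 1) + card E" if j: "j < p - 1" for j
  proof -
    have "(p * G) * k \<le> card (C j)" using big[OF j] by (simp add: G_def mult_ac)
    moreover have "1 \<le> p * G" using G1 pars by simp
    ultimately obtain S where S: "S \<subseteq> C j" "card S = k"
       "p * G * card {y \<in> E \<inter> U j. \<exists>x\<in>S. R y x} \<le> G * card (E \<inter> U j)"
      using block_avoiding_most[of "C j" "E \<inter> U j" "p * G" k G] finC[OF j] finE
      by (fastforce simp: U_def)
    let ?H = "{y \<in> E \<inter> U j. \<exists>x\<in>S. R y x}"
    have "G * (p * card ?H) \<le> G * card (E \<inter> U j)" using S(3) by (simp add: mult_ac)
    then have "p * card ?H \<le> card (E \<inter> U j)" using G1 by simp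
    also have "\<dots> \<le> card E" using finE by (intro card_mono) auto
    finally have H: "p * card ?H \<le> card E" .
    have "U j \<subseteq> miss S \<union> ?H"
    proof
      fix y assume y: "y \<in> U j"
      have "y \<in> E" if "x \<in> S" "R y x" for x
      proof -
        have "\<exists>i<p-1. i \<noteq> j \<and> y \<in> U i"
          using that y S(1) sym by (intro edge[OF j, of x]) (auto simp: U_def)
        then show ?thesis using y j by (auto simp: E_def U_def)
      qed
      then show "y \<in> miss S \<union> ?H" using y by (auto simp: miss_def U_def)
    qed
    then have "card (U j) \<le> card (miss S \<union> ?H)" using finE by (intro card_mono) auto
    also have "\<dots> \<le> card (miss S) + card ?H" by (rule card_Un_le)
    also have "card (miss S) \<le> n - 1"
      using no_book[of S] S(1,2) C[OF j] stable_subset[OF stable_C[OF j]] by fastforce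
    finally have "card (U j) \<le> n - 1 + card ?H" by simp
    then have "p * card (U j) \<le> p * (n - 1 + card ?H)" by (rule mult_left_mono) simp
    then show ?thesis using H by (simp add: algebra_simps)
  qed
  have "card V + card E \<le> (\<Sum>j<p-1. card (U j))"
  proof -
    have "card V + card E = (\<Sum>v\<in>V. 1 + (if v \<in> E then 1 else 0))"
    proof -
      have "{v \<in> V. v \<in> E} = E" by (auto simp: E_def)
      then show ?thesis using finite_V by (subst sum.distrib) (simp add: sum.If_cases Int_def)
    qed
    also have "\<dots> \<le> (\<Sum>v\<in>V. card {j \<in> {..<p-1}. v \<in> U j})"
    proof (intro sum_mono)
      fix v assume v: "v \<in> V"
      show "1 + (if v \<in> E then 1 else 0) \<le> card {j \<in> {..<p-1}. v \<in> U j}"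
      proof (cases "v \<in> E")
        case True
        then obtain i j where "i < p - 1" "j < p - 1" "i \<noteq> j" "v \<in> U i" "v \<in> U j"
          by (auto simp: E_def)
        then have "card {i, j} \<le> card {j \<in> {..<p-1}. v \<in> U j}"
          by (intro card_mono) auto
        moreover have "card {i, j} = 2" using \<open>i \<noteq> j\<close> by simp
        ultimately show ?thesis using True by simp
      next
        case False
        obtain j where "j < p - 1" "v \<in> U j" using cover[OF v] by blast
        then have "card {j} \<le> card {j \<in> {..<p-1}. v \<in> U j}"
          by (intro card_mono) auto
        then show ?thesis using False by simp
      qed
    qed
    also have "\<dots> = (\<Sum>j<p-1. card {v \<in> V. v \<in> U j})"
      using sum_card_swap[of "{..<p-1}" V "\<lambda>j v. v \<in> U j"] finite_V by simp
    also have "\<dots> = (\<Sum>j<p-1. card (U j))"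
      by (intro sum.cong arg_cong[of _ _ card]) (auto simp: U_def)
    finally show ?thesis .
  qed
  then have "p * (card V + card E) \<le> p * (\<Sum>j<p-1. card (U j))" by (rule mult_left_mono) simp
  also have "\<dots> = (\<Sum>j<p-1. p * card (U j))" by (rule sum_distrib_left)
  also have "\<dots> \<le> (\<Sum>j<p-1. p * (n - 1) + card E)" using size by (intro sum_mono) auto
  also have "\<dots> = p * ((p - 1) * (n - 1)) + (p - 1) * card E"
    by (simp add: add_mult_distrib2 mult.left_commute)
  also have "\<dots> \<le> p * ((p - 1) * (n - 1)) + p * card E"
    by (intro add_left_mono mult_right_mono) auto
  finally have "p * card V \<le> p * ((p - 1) * (n - 1))"
    by (simp only: add_mult_distrib2 add_le_cancel_right)
  then have "card V \<le> (p - 1) * (n - 1)" using pars by simp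
  then show False using card_V by simp
qed

section \<open>Choice of the parameters\<close>

text \<open>
  Here \<open>s\<close> is the final size of the sets \<open>A\<^sub>i\<close>, \<open>b\<close> bounds their initial size, \<open>e\<close> is the number of vertices
  left uncovered by them, \<open>d\<close> and \<open>g\<close> bound the numbers of neighbours within a class and of
  non-neighbours in another class, and \<open>q\<close> is the size of the stable set used to bound the number of
  exceptional vertices. The hypotheses on \<open>e\<close> are what \<open>few_exceptional\<close> and \<open>no_stable_partition\<close>
  require.
\<close>

lemma contradiction_if_parameters:
  assumes s: "t + 2 * k \<le> s" and h: "2 * p * p \<le> h"
    and b: "(s * h) ^ p * t \<le> b" "2 * (2 ^ (b * p) * (b ^ (p * t) * m)) \<le> n"
    and d: "d = 2 ^ (s * p) * m"
    and q: "\<And>e. h * e \<le> h * (2 ^ (b * p) * m) + p * (p * n) \<Longrightarrow>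
          q ^ Suc k * ((1 + p * s ^ k + p * p) * e + k * d) + k * (p * n) < q * g"
    and g: "\<And>e. h * e \<le> h * (2 ^ (b * p) * m) + p * (p * n) \<Longrightarrow>
          p * k * (t + m + d + 1 + t * g * p + g) + g +
          ((1 + p * s ^ k + p * p) * e + p * p * (q * (d + 1))) \<le> n"
  shows False
proof -
  \<comment> \<open>The exponent is \<open>p - j\<close> and not \<open>p - 1 - j\<close>, since one more factor \<open>s * h\<close> is used up when the last
    \<open>p - 1\<close> sets are replaced by blocks.\<close>
  define \<sigma> where "\<sigma> = (\<lambda>j. (s * h) ^ (p - j) * t)"
  have sh: "1 \<le> s * h" using s h pars by (cases s; cases h) auto
  have \<sigma>1: "\<sigma> j = s * h * \<sigma> (Suc j)" if "j < p - 1" for j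
  proof -
    have "p - j = Suc (p - Suc j)" using that by simp
    then show ?thesis by (simp add: \<sigma>_def)
  qed
  have \<sigma>2: "1 \<le> \<sigma> j \<and> \<sigma> j \<le> b" for j
  proof -
    have "(s * h) ^ (p - j) \<le> (s * h) ^ p" using sh by (intro power_increasing) auto
    then have "\<sigma> j \<le> (s * h) ^ p * t" unfolding \<sigma>_def by (rule mult_right_mono) simp
    then have "\<sigma> j \<le> b" using b(1) by linarith
    moreover have "1 \<le> (s * h) ^ (p - j)" using sh by (rule one_le_power)
    ultimately show ?thesis using pars by (simp add: \<sigma>_def)
  qed
  have "p - (p - 1) = 1" using pars by simp
  then have \<sigma>3: "\<sigma> (p - 1) = s * (h * t)" by (simp add: \<sigma>_def)
  have "k \<le> s" using s by simp
  obtain A where A: "\<forall>i<p-1. A i \<subseteq> V \<and> stable (A i) \<and> card (A i) = s"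
      "\<forall>i<p-1. \<forall>l<p-1. i \<noteq> l \<longrightarrow> complete_to (A i) (A l)"
      "h * card (V - (\<Union>i<p-1. miss (A i))) \<le> h * (2 ^ (b * p) * m) + p * card V"
    using nearly_covering_blowup[where \<sigma> = \<sigma> and s = s and h = h and b = b,
        OF \<sigma>1 \<sigma>2 \<sigma>3 \<open>k \<le> s\<close> h b(2)] by blast
  define e where "e = card (V - (\<Union>i<p-1. miss (A i)))"
  have "p * card V \<le> p * (p * n)" using card_V_le by (rule mult_left_mono) simp
  then have e: "h * e \<le> h * (2 ^ (b * p) * m) + p * (p * n)"
    using A(3) unfolding e_def by linarith
  define f where "f = (1 + p * s ^ k + p * p) * e"
  obtain C where C: "\<And>i. i < p - 1 \<Longrightarrow> C i \<subseteq> V \<and> card (C i) < n"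
     "card (V - (\<Union>i<p-1. C i)) \<le> f"
     "\<And>i j. i < p - 1 \<Longrightarrow> j < p - 1 \<Longrightarrow> i \<noteq> j \<Longrightarrow> C i \<inter> C j = {}"
     "\<And>i x. i < p - 1 \<Longrightarrow> x \<in> C i \<Longrightarrow> card (nbrs x (C i)) \<le> d"
  proof (rule that)
    let ?C = "\<lambda>i. {v \<in> miss (A i). \<forall>j<p-1. j \<noteq> i \<longrightarrow> v \<notin> {v \<in> V. k \<le> card {y \<in> A j. \<not> R v y}}}"
    have core: "i < p - 1 \<Longrightarrow> A i \<subseteq> V \<and> stable (A i) \<and> card (A i) = s"
       "i < p - 1 \<Longrightarrow> l < p - 1 \<Longrightarrow> i \<noteq> l \<Longrightarrow> complete_to (A i) (A l)" for i l
      using A by auto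
    have "card (?C i) < n" if "i < p - 1" for i
      by (rule stability_core(1)[where A = A and s = s and e = e]) (use core s e_def that in auto)
    moreover have "?C i \<subseteq> V" for i by (auto simp: miss_def)
    ultimately show "?C i \<subseteq> V \<and> card (?C i) < n" if "i < p - 1" for i
      using that by blast
    show "card (V - (\<Union>i<p-1. ?C i)) \<le> f"
      unfolding f_def by (rule stability_core(2)[where A = A and s = s and e = e]) (use core s e_def in auto)
    show "?C i \<inter> ?C j = {}" if "i < p - 1" "j < p - 1" "i \<noteq> j" for i j
      by (rule stability_core(3)[where A = A and s = s and e = e]) (use core s e_def that in auto)
    show "card (nbrs x (?C i)) \<le> d" if "i < p - 1" "x \<in> ?C i" for i x
      unfolding d
      by (rule stability_core(4)[where A = A and s = s and e = e]) (use core s e_def that in auto)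
  qed
  have num: "q ^ Suc k * (f + k * d) + k * card V < q * g"
  proof -
    have "k * card V \<le> k * (p * n)" using card_V_le by (rule mult_left_mono) simp
    then show ?thesis using q[OF e] unfolding f_def by linarith
  qed
  define D where "D = (\<lambda>i j. {x \<in> C i. g < card {y \<in> C j. \<not> R x y}})"
  have D: "card (D i j) \<le> q * (d + 1)" if "i < p - 1" "j < p - 1" "i \<noteq> j" for i j
    unfolding D_def
    by (rule few_exceptional[where C = C and d = d and f = f, OF C(1) C(3) C(2) C(4) num that]) auto
  define C' where "C' = (\<lambda>i. C i - (\<Union>j\<in>{..<p-1} - {i}. D i j))"
  have C'V: "C' i \<subseteq> V \<and> card (C' i) < n" if "i < p - 1" for i
  proof -
    have "finite (C i)" using C(1)[OF that] finite_V finite_subset by blast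
    then have "card (C' i) \<le> card (C i)" by (intro card_mono) (auto simp: C'_def)
    then show ?thesis using C(1)[OF that] by (auto simp: C'_def)
  qed
  let ?P = "{..<p-1} \<times> {..<p-1} - Id"
  have rest: "card (V - (\<Union>i<p-1. C' i)) \<le> f + p * p * (q * (d + 1))"
  proof -
    have "finite (D i j)" if "i < p - 1" for i j
      using C(1)[OF that] finite_V finite_subset[of "D i j" V] by (auto simp: D_def)
    then have "finite (\<Union>ij\<in>?P. D (fst ij) (snd ij))" by auto
    moreover have "V - (\<Union>i<p-1. C' i) \<subseteq> (V - (\<Union>i<p-1. C i)) \<union> (\<Union>ij\<in>?P. D (fst ij) (snd ij))"
    proof
      fix v assume v: "v \<in> V - (\<Union>i<p-1. C' i)"
      show "v \<in> (V - (\<Union>i<p-1. C i)) \<union> (\<Union>ij\<in>?P. D (fst ij) (snd ij))"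
      proof (cases "\<exists>i<p-1. v \<in> C i")
        case True
        then obtain i where i: "i < p - 1" "v \<in> C i" by blast
        then have "v \<notin> C' i" using v by blast
        then obtain j where "j < p - 1" "j \<noteq> i" "v \<in> D i j" using i by (auto simp: C'_def)
        then have "(i, j) \<in> ?P" "v \<in> D (fst (i, j)) (snd (i, j))" using i by auto
        then show ?thesis by blast
      qed (use v in auto)
    qed
    ultimately have "card (V - (\<Union>i<p-1. C' i)) \<le> card ((V - (\<Union>i<p-1. C i)) \<union> (\<Union>ij\<in>?P. D (fst ij) (snd ij)))"
      using finite_V by (intro card_mono) auto
    also have "\<dots> \<le> f + card (\<Union>ij\<in>?P. D (fst ij) (snd ij))"
      by (rule order_trans[OF card_Un_le]) (use C(2) in simp)
    also have "card (\<Union>ij\<in>?P. D (fst ij) (snd ij)) \<le> (\<Sum>ij\<in>?P. card (D (fst ij) (snd ij)))"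
      by (intro card_UN_le) simp
    also have "\<dots> \<le> (\<Sum>ij\<in>?P. q * (d + 1))"
    proof (rule sum_mono)
      fix ij assume "ij \<in> ?P"
      then show "card (D (fst ij) (snd ij)) \<le> q * (d + 1)"
        by (intro D) auto
    qed
    also have "\<dots> = card ?P * (q * (d + 1))" by simp
    also have "\<dots> \<le> p * p * (q * (d + 1))"
    proof (rule mult_right_mono)
      have "card ?P \<le> card ({..<p-1} \<times> {..<p-1})" by (intro card_mono) auto
      also have "\<dots> = (p - 1) * (p - 1)" by (simp only: card_cartesian_product card_lessThan)
      also have "\<dots> \<le> p * p" by (intro mult_mono) auto
      finally show "card ?P \<le> p * p" .
    qed simp
    finally show ?thesis by simp
  qed
  show False
  proof (rule no_stable_partition[where C = C' and g = g and b = "t + m + d + 1"])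
    fix i j x assume ij: "i < p - 1" "j < p - 1" "i \<noteq> j" and x: "x \<in> C' i"
    have "finite {y \<in> C j. \<not> R x y}" using C(1)[OF ij(2)] finite_V finite_subset by fastforce
    then have "card {y \<in> C' j. \<not> R x y} \<le> card {y \<in> C j. \<not> R x y}"
      by (intro card_mono) (auto simp: C'_def)
    also have "\<dots> \<le> g" using x ij by (auto simp: C'_def D_def not_less)
    finally show "card {y \<in> C' j. \<not> R x y} \<le> g" .
  next
    fix i x assume i: "i < p - 1" and x: "x \<in> C' i"
    have "finite (C i)" using C(1)[OF i] finite_V finite_subset by blast
    then have "card (nbrs x (C' i)) \<le> card (nbrs x (C i))"
      by (intro card_mono) (auto simp: C'_def nbrs_def)
    also have "\<dots> \<le> d" using C(4)[OF i] x by (simp add: C'_def)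
    finally show "card (nbrs x (C' i)) < t + m + d + 1 + t * g * p" by simp
  next
    fix i assume i: "i < p - 1"
    have "n \<le> card (C' i) + (f + p * p * (q * (d + 1)))"
      using large_class[where B = C' and X = "{}", OF C'V rest i] by simp
    then show "p * k * (t + m + d + 1 + t * g * p + g) + g \<le> card (C' i)"
      using g[OF e] unfolding f_def by linarith
  qed (use C'V in auto)
qed

text \<open>
  With powers of \<open>u\<close> for the sizes, \<open>k\<close>, \<open>p\<close>, \<open>t\<close> and all numerical constants are absorbed by changing exponents.
  The final count tolerates \<open>g = n div u ^ 7\<close> non-neighbours. Then \<open>q = u ^ 11\<close> makes \<open>q * g\<close> much larger
  than \<open>k * card V\<close>, and \<open>h\<close> has to outweigh the factor \<open>q ^ Suc k * s ^ k = u ^ (13 * k + 11)\<close> by which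
  the number of uncovered vertices gets multiplied.
\<close>

lemma contradiction_if_large:
  assumes u: "k \<le> u" "p \<le> u" "t \<le> u" "32 \<le> u"
    and b: "b = u ^ ((13 * k + 22) * p + 1)" and n: "2 ^ (b * u ^ 4) * m \<le> n"
  shows False
proof -
  define X where "X = 2 ^ (b * p) * m"
  define s where "s = u ^ 2"
  define h where "h = u ^ (13 * k + 20)"
  define d where "d = 2 ^ (s * p) * m"
  define g where "g = n div u ^ 7"
  define q where "q = u ^ 11"
  have u1: "1 \<le> u" using u by simp
  have mono: "u ^ i \<le> u ^ j" if "i \<le> j" for i j using that u1 by (rule power_increasing)
  have b1: "1 \<le> b" using u1 unfolding b by (rule one_le_power)
  have s1: "t + 2 * k \<le> s"
  proof -
    have "t + 2 * k \<le> 3 * u" using u by simp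
    also have "\<dots> \<le> u * u" using u by (intro mult_right_mono) auto
    finally show ?thesis by (simp add: s_def power2_eq_square)
  qed
  have pp: "p * p \<le> u ^ 2" using u by (simp add: power2_eq_square mult_mono)
  have h1: "2 * p * p \<le> h"
  proof -
    have "2 * p * p \<le> u * u ^ 2" using pp u by (simp add: mult.assoc mult_mono)
    also have "\<dots> = u ^ 3" by (simp add: power3_eq_cube power2_eq_square)
    also have "\<dots> \<le> h" unfolding h_def by (rule mono) simp
    finally show ?thesis .
  qed
  have b2: "(s * h) ^ p * t \<le> b"
  proof -
    have "(s * h) ^ p = u ^ ((13 * k + 22) * p)"
      by (simp add: s_def h_def power_add[symmetric] power_mult[symmetric] add.commute)
    then show ?thesis using u by (simp add: b)
  qed
  have b3: "2 * (2 ^ (b * p) * (b ^ (p * t) * m)) \<le> n"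
  proof -
    have "b ^ (p * t) \<le> (2 ^ b) ^ (p * t)" by (intro power_mono) (simp_all add: less_imp_le)
    then have "2 * (2 ^ (b * p) * (b ^ (p * t) * m)) \<le> 2 * (2 ^ (b * p) * ((2 ^ b) ^ (p * t) * m))"
      by (intro mult_left_mono mult_right_mono) auto
    also have "\<dots> = 2 ^ (1 + b * p + b * (p * t)) * m" by (simp add: power_add power_mult)
    also have "\<dots> \<le> 2 ^ (b * u ^ 4) * m"
    proof (intro mult_right_mono power_increasing)
      have "p * t \<le> u * u" using u by (intro mult_mono) auto
      then have "1 + p + p * t \<le> 1 + u + u * u" using u by linarith
      also have "\<dots> \<le> u ^ 3"
      proof -
        have "3 * (u * u) \<le> u * (u * u)" using u by (intro mult_right_mono) auto
        moreover have "1 \<le> u * u" "u \<le> u * u" using u1 by auto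
        ultimately show ?thesis unfolding power3_eq_cube mult.assoc by linarith
      qed
      also have "\<dots> \<le> u ^ 4" by (rule mono) simp
      finally have "b * (1 + p + p * t) \<le> b * u ^ 4" by (rule mult_left_mono) simp
      then show "1 + b * p + b * (p * t) \<le> b * u ^ 4" using b1 by (simp add: algebra_simps)
    qed auto
    finally show ?thesis using n by linarith
  qed
  have X1: "1 \<le> X" using pars by (simp add: X_def)
  \<comment> \<open>\<open>X\<close> bounds all quantities coming from the pigeonhole principle. It is so much smaller than \<open>n\<close> that
    the powers of \<open>u\<close> by which it gets multiplied do not matter.\<close>
  have KX: "u ^ (13 * k + 30) * X \<le> n"
  proof -
    have "u ^ (13 * k + 30) \<le> b" unfolding b
    proof (rule mono)
      have "13 * k + 30 \<le> (13 * k + 22) * 3" by simp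
      also have "\<dots> \<le> (13 * k + 22) * p" using pars by (intro mult_left_mono) auto
      finally show "13 * k + 30 \<le> (13 * k + 22) * p + 1" by simp
    qed
    also have "\<dots> \<le> 2 ^ b" by (simp add: less_imp_le)
    finally have "u ^ (13 * k + 30) * X \<le> 2 ^ b * X" by (rule mult_right_mono) simp
    also have "\<dots> = 2 ^ (b + b * p) * m" by (simp add: X_def power_add)
    also have "\<dots> \<le> 2 ^ (b * u ^ 4) * m"
    proof (intro mult_right_mono power_increasing)
      have "2 * u \<le> u * u" using u by (intro mult_right_mono) auto
      then have "1 + p \<le> u * u" using u by linarith
      also have "\<dots> \<le> u ^ 4" using mono[of 2 4] by (simp add: power2_eq_square)
      finally have "b * (1 + p) \<le> b * u ^ 4" by (rule mult_left_mono) simp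
      then show "b + b * p \<le> b * u ^ 4" by simp
    qed auto
    finally show ?thesis using n by linarith
  qed
  have K: "u ^ i * X \<le> n" if "i \<le> 13 * k + 30" for i
    using mult_right_mono[OF mono[OF that], of X] KX by linarith
  have dX: "d \<le> X"
  proof -
    have "s \<le> b" unfolding s_def b
    proof (rule mono)
      have "1 * 1 \<le> (13 * k + 22) * p" using pars by (intro mult_mono) auto
      then show "2 \<le> (13 * k + 22) * p + 1" by (metis add_le_mono1 mult_1 one_add_one)
    qed
    then show ?thesis unfolding d_def X_def by (intro mult_right_mono power_increasing) auto
  qed
  have e_bound: "u ^ (13 * k + 17) * e \<le> n" if "h * e \<le> h * X + p * (p * n)" for e
  proof -
    have "h * X \<le> n" unfolding h_def by (rule K) simp
    moreover have "p * (p * n) \<le> u ^ 2 * n" using mult_right_mono[OF pp, of n] by (simp add: mult.assoc)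
    ultimately have "h * e \<le> n + u ^ 2 * n" using that by linarith
    also have "\<dots> \<le> u ^ 2 * n + u ^ 2 * n" using u1 by simp
    also have "\<dots> = 2 * (u ^ 2 * n)" by simp
    also have "\<dots> \<le> u * (u ^ 2 * n)" using u by (intro mult_right_mono) auto
    also have "\<dots> = u ^ 3 * n" by (simp add: power3_eq_cube power2_eq_square)
    finally have "u ^ 3 * (u ^ (13 * k + 17) * e) \<le> u ^ 3 * n"
      by (simp add: h_def power_add mult_ac)
    then show ?thesis using u1 by simp
  qed
  define F where "F = (\<lambda>e. (1 + p * s ^ k + p * p) * e)"
  have F: "F e \<le> u ^ (2 * k + 3) * e" for e
    unfolding F_def
  proof (rule mult_right_mono)
    have "p * s ^ k \<le> u * u ^ (2 * k)" using u by (simp add: s_def power_mult[symmetric])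
    also have "\<dots> = u ^ (2 * k + 1)" by simp
    also have "\<dots> \<le> u ^ (2 * k + 2)" by (rule mono) simp
    finally have "p * s ^ k \<le> u ^ (2 * k + 2)" .
    moreover have "p * p \<le> u ^ (2 * k + 2)" using pp mono[of 2 "2 * k + 2"] by simp
    moreover have "1 \<le> u ^ (2 * k + 2)" using u1 by (rule one_le_power)
    ultimately have "1 + p * s ^ k + p * p \<le> 3 * u ^ (2 * k + 2)" by linarith
    also have "\<dots> \<le> u * u ^ (2 * k + 2)" using u by (intro mult_right_mono) auto
    finally show "1 + p * s ^ k + p * p \<le> u ^ (2 * k + 3)" by (simp add: numeral_3_eq_3)
  qed simp
  show False
  proof (rule contradiction_if_parameters[where s = s and h = h and b = b and d = d and q = q and g = g,
      OF s1 h1 b2 b3 d_def, folded X_def F_def])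
    fix e assume "h * e \<le> h * X + p * (p * n)"
    note e = e_bound[OF this]
    have qk: "q ^ Suc k = u ^ (11 * k + 11)" by (simp add: q_def power_mult[symmetric] power_add)
    have uu: "u * u = u ^ 2" by (simp add: power2_eq_square)
    have pw: "u ^ i * (u ^ j * x) = u ^ l * x" if "i + j = l" for i j l x
      unfolding that[symmetric] by (simp add: power_add)
    have pw': "u * (u ^ i * x) = u ^ l * x" if "Suc i = l" for i l x
      unfolding that[symmetric] by simp
    have Xu: "X \<le> u * X" using u1 by simp
    show "q ^ Suc k * (F e + k * d) + k * (p * n) < q * g"
    proof -
      have "u ^ 3 * (q ^ Suc k * F e) \<le> u ^ 3 * (u ^ (11 * k + 11) * (u ^ (2 * k + 3) * e))"
        unfolding qk by (intro mult_left_mono F) auto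
      also have "\<dots> = u ^ (13 * k + 17) * e"
        unfolding pw[OF refl] by (intro arg_cong2[of _ _ _ _ "(*)"] arg_cong[of _ _ "(^) u"]) simp_all
      finally have 1: "u ^ 3 * (q ^ Suc k * F e) \<le> n" using e by linarith
      have "u ^ 3 * (q ^ Suc k * (k * d)) \<le> u ^ 3 * (u ^ (11 * k + 11) * (u ^ 1 * X))"
        unfolding qk using u dX by (intro mult_left_mono mult_mono) auto
      also have "\<dots> = u ^ (11 * k + 15) * X"
        unfolding pw[OF refl] by (intro arg_cong2[of _ _ _ _ "(*)"] arg_cong[of _ _ "(^) u"]) simp_all
      also have "\<dots> \<le> n" by (rule K) simp
      finally have 2: "u ^ 3 * (q ^ Suc k * (k * d)) \<le> n" .
      let ?A = "q ^ Suc k * (F e + k * d)"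
      have "2 * ?A \<le> u ^ 3 * ?A"
        using order_trans[OF _ mono[of 1 3], of 2] u by (intro mult_right_mono) auto
      also have "\<dots> = u ^ 3 * (q ^ Suc k * F e) + u ^ 3 * (q ^ Suc k * (k * d))"
        by (simp only: add_mult_distrib2)
      finally have A: "?A \<le> n" using 1 2 by linarith
      have "k * (p * n) \<le> u * (u * n)" using u by (intro mult_mono) auto
      then have B: "k * (p * n) \<le> u ^ 2 * n" by (simp add: power2_eq_square mult.assoc)
      have "n < u ^ 7 * (g + 1)"
        using dividend_less_times_div[of "u ^ 7" n] u1 by (simp add: g_def)
      then have "u ^ 4 * n < u ^ 4 * (u ^ 7 * (g + 1))" using u1 by simp
      also have "\<dots> = q * g + u ^ 11" by (simp add: q_def algebra_simps power_add[symmetric] mult.assoc[symmetric])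
      also have "u ^ 11 \<le> n" using order_trans[OF mult_left_mono[OF X1, of "u ^ 11"] K[of 11]] by simp
      finally have G: "u ^ 4 * n < q * g + n" by simp
      have "3 * (u ^ 2 * n) \<le> u ^ 2 * (u ^ 2 * n)"
        using order_trans[OF _ mono[of 1 2], of 3] u by (intro mult_right_mono) auto
      also have "\<dots> = u ^ 4 * n" by (rule pw) simp
      finally have "3 * (u ^ 2 * n) \<le> u ^ 4 * n" .
      moreover have "n \<le> u ^ 2 * n" using u1 by simp
      ultimately show ?thesis using A B G by linarith
    qed
    show "p * k * (t + m + d + 1 + t * g * p + g) + g + (F e + p * p * (q * (d + 1))) \<le> n"
    proof -
      have pk: "p * k \<le> u ^ 2" using mult_mono[OF u(2,1)] by (simp add: uu)
      have "m \<le> X" by (simp add: X_def)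
      moreover have "t \<le> u * X" using mult_mono[OF u(3) X1] by simp
      ultimately have "t + m + d + 1 \<le> u * X + 3 * X" using dX X1 by linarith
      also have "\<dots> \<le> u ^ 2 * X"
      proof -
        have "4 * (u * X) \<le> u * (u * X)" using u by (intro mult_right_mono) auto
        then show ?thesis using Xu unfolding power2_eq_square mult.assoc by linarith
      qed
      finally have "p * k * (t + m + d + 1) \<le> u ^ 2 * (u ^ 2 * X)"
        by (intro mult_mono pk) auto
      also have "\<dots> = u ^ 4 * X" by (rule pw) simp
      finally have "4 * (p * k * (t + m + d + 1)) \<le> 4 * (u ^ 4 * X)" by (rule mult_left_mono) simp
      also have "\<dots> \<le> u * (u ^ 4 * X)" using u by (intro mult_right_mono) auto
      also have "\<dots> = u ^ 5 * X" by (rule pw') simp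
      also have "\<dots> \<le> n" by (rule K) simp
      finally have 1: "4 * (p * k * (t + m + d + 1)) \<le> n" .
      have "t * g * p = (t * p) * g" by simp
      also have "\<dots> \<le> u ^ 2 * g" using mult_mono[OF u(3,2)] by (intro mult_right_mono) (auto simp: uu)
      finally have "t * g * p + g \<le> u ^ 2 * g + u ^ 2 * g" using u1 by (intro add_mono) auto
      also have "\<dots> = 2 * (u ^ 2 * g)" by simp
      finally have "p * k * (t * g * p + g) \<le> u ^ 2 * (2 * (u ^ 2 * g))" by (intro mult_mono pk) auto
      also have "\<dots> = 2 * (u ^ 4 * g)" using pw[of 2 2 4 g] by simp
      finally have "p * k * (t * g * p + g) \<le> 2 * (u ^ 4 * g)" .
      moreover have "g \<le> u ^ 4 * g" using u1 by simp
      moreover have "4 * (x + g) \<le> 12 * y" if "x \<le> 2 * y" "g \<le> y" for x y :: nat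
        using that by simp
      ultimately have "4 * (p * k * (t * g * p + g) + g) \<le> 12 * (u ^ 4 * g)" by blast
      also have "\<dots> \<le> u * (u ^ 4 * g)" using u by (intro mult_right_mono) auto
      also have "\<dots> = u ^ 5 * g" by (rule pw') simp
      also have "\<dots> \<le> u ^ 7 * g" by (intro mult_right_mono mono) auto
      also have "\<dots> \<le> n" by (simp add: g_def)
      finally have 2: "4 * (p * k * (t * g * p + g) + g) \<le> n" .
      have "4 * F e \<le> u * (u ^ (2 * k + 3) * e)" using F[of e] u by (intro mult_mono) auto
      also have "\<dots> = u ^ (2 * k + 4) * e"
        by (rule pw') simp
      also have "\<dots> \<le> u ^ (13 * k + 17) * e" by (intro mult_right_mono mono) auto
      finally have 3: "4 * F e \<le> n" using e by linarith
      have "d + 1 \<le> 2 * X" using dX X1 by linarith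
      then have "p * p * (q * (d + 1)) \<le> u ^ 2 * (u ^ 11 * (2 * X))"
        unfolding q_def using pp by (intro mult_mono) auto
      also have "\<dots> = 2 * (u ^ 13 * X)" using pw[of 2 11 13 X] by simp
      finally have "4 * (p * p * (q * (d + 1))) \<le> 8 * (u ^ 13 * X)" by linarith
      also have "\<dots> \<le> u * (u ^ 13 * X)" using u by (intro mult_right_mono) auto
      also have "\<dots> = u ^ 14 * X" by (rule pw') simp
      also have "\<dots> \<le> n" by (rule K) simp
      finally have 4: "4 * (p * p * (q * (d + 1))) \<le> n" .
      have "p * k * (t + m + d + 1 + t * g * p + g) = p * k * (t + m + d + 1) + p * k * (t * g * p + g)"
        by (simp only: add_mult_distrib2[symmetric] add.assoc)
      moreover have "w + x + g + (y + z) \<le> n"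
        if "4 * w \<le> n" "4 * (x + g) \<le> n" "4 * y \<le> n" "4 * z \<le> n" for w x y z :: nat
        using that by presburger
      ultimately show ?thesis using 1 2 3 4 by simp
    qed
  qed
qed

end

section \<open>Copies of books and complete multipartite graphs\<close>

lemma ball_doubletons: "(\<forall>e\<in>{{u, v} |u v. P u v}. Q e) \<longleftrightarrow> (\<forall>u v. P u v \<longrightarrow> Q {u, v})"
  by blast

lemma contains_copy_book_iff:
  "contains_copy \<Gamma> (book k n) \<longleftrightarrow>
     (\<exists>f. inj_on f {..<n} \<and> f ` {..<n} \<subseteq> verts \<Gamma> \<and>
          (\<forall>u v. u < k \<and> u < n \<and> v < n \<and> u \<noteq> v \<longrightarrow> {f u, f v} \<in> edges \<Gamma>))"
  unfolding contains_copy_def book_def fst_conv snd_conv ball_doubletons image_insert image_empty ..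

lemma contains_copy_multipartite_iff:
  "contains_copy \<Gamma> (complete_multipartite p a) \<longleftrightarrow>
     (\<exists>f. inj_on f (Sigma {1..p} (\<lambda>i. {..<a i})) \<and> f ` Sigma {1..p} (\<lambda>i. {..<a i}) \<subseteq> verts \<Gamma> \<and>
        (\<forall>i x j y. (i \<in> {1..p} \<and> x < a i) \<and> (j \<in> {1..p} \<and> y < a j) \<and> i \<noteq> j \<longrightarrow>
            {f (i, x), f (j, y)} \<in> edges \<Gamma>))"
  unfolding contains_copy_def complete_multipartite_def Let_def fst_conv snd_conv ball_doubletons
    image_insert image_empty split_paired_All mem_Sigma_iff lessThan_iff ..

lemma multipartite_copyE:
  assumes "contains_copy \<Gamma> (complete_multipartite p a)"
  obtains f where "inj_on f (Sigma {1..p} (\<lambda>i. {..<a i}))"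
    "\<And>i x. i \<in> {1..p} \<Longrightarrow> x < a i \<Longrightarrow> f (i, x) \<in> verts \<Gamma>"
    "\<And>i j x y. i \<in> {1..p} \<Longrightarrow> j \<in> {1..p} \<Longrightarrow> x < a i \<Longrightarrow> y < a j \<Longrightarrow> i \<noteq> j \<Longrightarrow>
       {f (i, x), f (j, y)} \<in> edges \<Gamma>"
proof -
  obtain f where f: "inj_on f (Sigma {1..p} (\<lambda>i. {..<a i}))"
     "f ` Sigma {1..p} (\<lambda>i. {..<a i}) \<subseteq> verts \<Gamma>"
     "\<forall>i x j y. (i \<in> {1..p} \<and> x < a i) \<and> (j \<in> {1..p} \<and> y < a j) \<and> i \<noteq> j \<longrightarrow>
            {f (i, x), f (j, y)} \<in> edges \<Gamma>"
    using assms unfolding contains_copy_multipartite_iff by (elim exE conjE)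
  show ?thesis
  proof (rule that[OF f(1)])
    show "f (i, x) \<in> verts \<Gamma>" if "i \<in> {1..p}" "x < a i" for i x
    proof -
      have "(i, x) \<in> Sigma {1..p} (\<lambda>i. {..<a i})" using that by simp
      then show ?thesis using f(2) by blast
    qed
  qed (use f(3) in blast)
qed

lemma book_copyE:
  assumes "contains_copy \<Gamma> (book k n)"
  obtains f where "inj_on f {..<n}" "\<And>v. v < n \<Longrightarrow> f v \<in> verts \<Gamma>"
    "\<And>u v. u < k \<Longrightarrow> u < n \<Longrightarrow> v < n \<Longrightarrow> u \<noteq> v \<Longrightarrow> {f u, f v} \<in> edges \<Gamma>"
proof -
  obtain f where f: "inj_on f {..<n}" "f ` {..<n} \<subseteq> verts \<Gamma>"
     "\<forall>u v. u < k \<and> u < n \<and> v < n \<and> u \<noteq> v \<longrightarrow> {f u, f v} \<in> edges \<Gamma>"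
    using assms unfolding contains_copy_book_iff by (elim exE conjE)
  show ?thesis
  proof (rule that[OF f(1)])
    show "f v \<in> verts \<Gamma>" if "v < n" for v using f(2) that by blast
  qed (use f(3) in blast)
qed

definition graph_of_rel :: "nat \<Rightarrow> (nat \<Rightarrow> nat \<Rightarrow> bool) \<Rightarrow> nat graph" where
  "graph_of_rel N R = ({..<N}, {{x, y} |x y. x < N \<and> y < N \<and> x \<noteq> y \<and> R x y})"

lemma finite_graph_of_rel: "finite_graph (graph_of_rel N R)"
  by (auto simp: finite_graph_def graph_of_rel_def)

lemma verts_graph_of_rel [simp]: "verts (graph_of_rel N R) = {..<N}"
  by (simp add: graph_of_rel_def)

lemma edge_graph_of_rel:
  assumes "\<And>x y. R x y \<Longrightarrow> R y x"
  shows "{x, y} \<in> edges (graph_of_rel N R) \<longleftrightarrow> x < N \<and> y < N \<and> x \<noteq> y \<and> R x y"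
  using assms by (auto simp: graph_of_rel_def doubleton_eq_iff)

lemma edge_complement:
  "{x, y} \<in> edges (complement_graph \<Gamma>) \<longleftrightarrow>
     x \<in> verts \<Gamma> \<and> y \<in> verts \<Gamma> \<and> x \<noteq> y \<and> {x, y} \<notin> edges \<Gamma>"
  by (auto simp: complement_graph_def)

lemma not_ramsey_propertyI:
  assumes "\<not> contains_copy (graph_of_rel N R) G"
    and "\<not> contains_copy (complement_graph (graph_of_rel N R)) H"
  shows "\<not> ramsey_property G H N"
  using assms finite_graph_of_rel[of N R] unfolding ramsey_property_def
  by (metis card_lessThan verts_graph_of_rel)

lemma card_class:
  fixes c :: nat
  assumes "0 < c"
  shows "card {y. y div c = q} = c" "finite {y. y div c = q}"
proof -
  have "{y. y div c = q} = {q * c..<Suc q * c}"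
  proof (intro set_eqI iffI)
    fix y assume "y \<in> {y. y div c = q}"
    then show "y \<in> {q * c..<Suc q * c}"
      using assms dividend_less_times_div[OF assms, of y] times_div_less_eq_dividend[of c y]
      by (auto simp: mult.commute)
  next
    fix y assume "y \<in> {q * c..<Suc q * c}"
    then show "y \<in> {y. y div c = q}" using div_nat_eqI[of c q y] by (auto simp: mult.commute)
  qed
  then show "card {y. y div c = q} = c" "finite {y. y div c = q}" by auto
qed

section \<open>Lower bounds\<close>

text \<open>
  The colouring by \<open>x div (n - 1)\<close> has at most \<open>p - 1\<close> classes, while \<open>G\<close> contains a clique on \<open>p\<close> vertices. A
  book in the complement is connected, hence lies in one class, which is too small.
\<close>

lemma multipartite_lower_bound:
  assumes p: "2 \<le> p" and k: "1 \<le> k" and n: "2 \<le> n"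
    and a: "\<And>i. i \<in> {1..p} \<Longrightarrow> 1 \<le> a i" and N: "N \<le> (p - 1) * (n - 1)"
  shows "\<not> ramsey_property (complete_multipartite p a) (book k n) N"
proof (rule not_ramsey_propertyI)
  define c where "c = n - 1"
  have c: "0 < c" using n by (simp add: c_def)
  let ?R = "\<lambda>x y. x div c \<noteq> y div c"
  show "\<not> contains_copy (graph_of_rel N ?R) (complete_multipartite p a)"
  proof
    assume "contains_copy (graph_of_rel N ?R) (complete_multipartite p a)"
    then obtain f where "inj_on f (Sigma {1..p} (\<lambda>i. {..<a i}))"
      and f: "\<And>i x. i \<in> {1..p} \<Longrightarrow> x < a i \<Longrightarrow> f (i, x) \<in> verts (graph_of_rel N ?R)"
      and adj: "\<And>i j x y. i \<in> {1..p} \<Longrightarrow> j \<in> {1..p} \<Longrightarrow> x < a i \<Longrightarrow> y < a j \<Longrightarrow> i \<noteq> j \<Longrightarrow>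
         {f (i, x), f (j, y)} \<in> edges (graph_of_rel N ?R)"
      by (rule multipartite_copyE) (rule that; fast)
    have "f (i, 0) div c \<in> {..<p-1}" if "i \<in> {1..p}" for i
    proof -
      have "f (i, 0) < N" using f[OF that, of 0] a[OF that] by simp
      then have "f (i, 0) < (p - 1) * c" using N by (simp add: c_def)
      then show ?thesis by (simp add: less_mult_imp_div_less)
    qed
    then have sub: "(\<lambda>i. f (i, 0) div c) ` {1..p} \<subseteq> {..<p-1}" by blast
    have "inj_on (\<lambda>i. f (i, 0) div c) {1..p}"
    proof (rule inj_onI, rule ccontr)
      fix i j assume ij: "i \<in> {1..p}" "j \<in> {1..p}" "f (i, 0) div c = f (j, 0) div c" "i \<noteq> j"
      have "{f (i, 0), f (j, 0)} \<in> edges (graph_of_rel N ?R)"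
        using ij a[OF ij(1)] a[OF ij(2)] by (intro adj) auto
      then show False using ij(3) by (subst (asm) edge_graph_of_rel) auto
    qed
    then have "card {1..p} \<le> card {..<p-1}" using sub by (intro card_inj_on_le) auto
    then show False using p by simp
  qed
  show "\<not> contains_copy (complement_graph (graph_of_rel N ?R)) (book k n)"
  proof
    assume "contains_copy (complement_graph (graph_of_rel N ?R)) (book k n)"
    then obtain f where f: "inj_on f {..<n}"
      and adj: "\<And>u v. u < k \<Longrightarrow> u < n \<Longrightarrow> v < n \<Longrightarrow> u \<noteq> v \<Longrightarrow>
         {f u, f v} \<in> edges (complement_graph (graph_of_rel N ?R))"
      by (rule book_copyE) (rule that; fast)
    have "f v div c = f 0 div c" if "v < n" for v
    proof (cases "v = 0")
      case False
      then have "{f 0, f v} \<in> edges (complement_graph (graph_of_rel N ?R))"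
        using k n that by (intro adj) auto
      then show ?thesis unfolding edge_complement by (subst (asm) edge_graph_of_rel) auto
    qed simp
    then have "f ` {..<n} \<subseteq> {y. y div c = f 0 div c}" by auto
    then have "card {..<n} \<le> card {y. y div c = f 0 div c}"
      using f card_class(2)[OF c] by (intro card_inj_on_le) auto
    then show False using card_class(1)[OF c] n by (simp add: c_def)
  qed
qed

text \<open>
  The class \<open>0\<close> consists of the first \<open>w = n - 1 + a 1\<close> vertices and is cut into cliques of size
  \<open>l = a 1 + 1\<close>; the last of them may be incomplete if \<open>l\<close> does not divide \<open>w\<close>. The other \<open>p - 2\<close> classes
  are stable and have \<open>n - 1\<close> elements. At most \<open>p - 2\<close> parts of \<open>G\<close> meet these, so two parts lie inside
  class \<open>0\<close>, and they must lie in a single clique. Of two spine vertices of a book inside class \<open>0\<close>, one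
  lies in a complete clique, whose other \<open>a 1\<close> vertices do not belong to the book.
\<close>

lemma clique_component_lower_bound:
  assumes p: "2 \<le> p" and k: "2 \<le> k" and n: "2 \<le> n"
    and a: "\<And>i. i \<in> {1..p} \<Longrightarrow> 1 \<le> a i" and mono: "mono_on {1..p} a" and a2: "2 \<le> a 2"
  shows "\<not> ramsey_property (complete_multipartite p a) (book k n) ((p - 1) * (n - 1) + a 1)"
proof -
  define N where "N = (p - 1) * (n - 1) + a 1"
  define w where "w = n - 1 + a 1"
  define l where "l = a 1 + 1"
  define c where "c = (\<lambda>x. if x < w then 0 else 1 + (x - w) div (n - 1))"
  define R where "R = (\<lambda>x y. c x \<noteq> c y \<or> c x = 0 \<and> x div l = y div l)"
  have l: "0 < l" by (simp add: l_def)
  have n1: "0 < n - 1" using n by simp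
  have symR: "R x y \<Longrightarrow> R y x" for x y by (auto simp: R_def)
  note edge = edge_graph_of_rel[of R, OF symR]
  have c0: "c x = 0 \<longleftrightarrow> x < w" for x by (simp add: c_def)
  have cN: "c x < p - 1" if "x < N" for x
  proof (cases "x < w")
    case False
    have "(p - 1) * (n - 1) = (p - 2) * (n - 1) + (n - 1)"
      using p by (metis Suc_1 Suc_diff_Suc Suc_le_lessD add.commute diff_Suc_1 diff_Suc_eq_diff_pred less_numeral_extra(1) mult_Suc One_nat_def plus_1_eq_Suc)
    then have "N = (p - 2) * (n - 1) + w" by (simp only: N_def w_def add.assoc)
    then have "x - w < (p - 2) * (n - 1)" using that False by linarith
    then have "(x - w) div (n - 1) < p - 2" by (rule less_mult_imp_div_less)
    then show ?thesis using False by (simp add: c_def)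
  qed (use p in \<open>simp add: c_def\<close>)
  have "\<not> contains_copy (graph_of_rel N R) (complete_multipartite p a)"
  proof
    assume "contains_copy (graph_of_rel N R) (complete_multipartite p a)"
    then obtain f where f: "inj_on f (Sigma {1..p} (\<lambda>i. {..<a i}))"
        "\<And>i x. i \<in> {1..p} \<Longrightarrow> x < a i \<Longrightarrow> f (i, x) \<in> verts (graph_of_rel N R)"
      and adj: "\<And>i j x y. i \<in> {1..p} \<Longrightarrow> j \<in> {1..p} \<Longrightarrow> x < a i \<Longrightarrow> y < a j \<Longrightarrow> i \<noteq> j \<Longrightarrow>
         {f (i, x), f (j, y)} \<in> edges (graph_of_rel N R)"
      by (rule multipartite_copyE) (rule that; fast)
    \<comment> \<open>Vertices of different parts of \<open>G\<close> are adjacent, so they lie in different stable classes.\<close>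
    define B where "B = {i \<in> {1..p}. \<exists>x<a i. c (f (i, x)) \<noteq> 0}"
    have "\<exists>x. i \<in> B \<longrightarrow> x < a i \<and> c (f (i, x)) \<noteq> 0" for i by (auto simp: B_def)
    then obtain g where g: "\<And>i. i \<in> B \<Longrightarrow> g i < a i \<and> c (f (i, g i)) \<noteq> 0" by metis
    have "inj_on (\<lambda>i. c (f (i, g i))) B"
    proof (rule inj_onI, rule ccontr)
      fix i j assume ij: "i \<in> B" "j \<in> B" "c (f (i, g i)) = c (f (j, g j))" "i \<noteq> j"
      then have "{f (i, g i), f (j, g j)} \<in> edges (graph_of_rel N R)"
        using g by (intro adj) (auto simp: B_def)
      then have "R (f (i, g i)) (f (j, g j))" by (simp add: edge)
      then show False using ij g by (auto simp: R_def)
    qed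
    moreover have "(\<lambda>i. c (f (i, g i))) ` B \<subseteq> {1..<p-1}"
    proof
      fix y assume "y \<in> (\<lambda>i. c (f (i, g i))) ` B"
      then obtain i where i: "i \<in> B" "y = c (f (i, g i))" by blast
      then have "f (i, g i) < N" using f(2) g[OF i(1)] by (simp add: B_def)
      then show "y \<in> {1..<p-1}" using cN g[OF i(1)] i(2) by auto
    qed
    ultimately have "card B \<le> card {1..<p-1}" by (intro card_inj_on_le) auto
    then have "card B \<le> p - 2" by simp
    moreover have finB: "finite B" "B \<subseteq> {1..p}" by (auto simp: B_def)
    ultimately have "2 \<le> card ({1..p} - B)" using p by (simp add: card_Diff_subset)
    then obtain i j where ij: "i \<in> {1..p} - B" "j \<in> {1..p} - B" "i < j"
    proof -
      obtain S where S: "S \<subseteq> {1..p} - B" "card S = 2"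
        using obtain_subset_with_card_n[of 2 "{1..p} - B"] \<open>2 \<le> card ({1..p} - B)\<close> by blast
      then obtain x y where xy: "S = {x, y}" "x \<noteq> y" by (auto simp: card_2_iff)
      then show ?thesis using S(1) that[of x y] that[of y x] by (cases "x < y") auto
    qed
    let ?S = "Sigma {i, j} (\<lambda>i. {..<a i})"
    have "f z div l = f (i, 0) div l" if z: "z \<in> ?S" for z
    proof -
      have comp: "f (i, x) div l = f (j, y) div l" if "x < a i" "y < a j" for x y
      proof -
        have "{f (i, x), f (j, y)} \<in> edges (graph_of_rel N R)"
          using that ij by (intro adj) auto
        then have "R (f (i, x)) (f (j, y))" by (simp add: edge)
        moreover have "c (f (i, x)) = 0" "c (f (j, y)) = 0" using ij that by (auto simp: B_def)
        ultimately show ?thesis by (simp add: R_def)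
      qed
      have pos: "0 < a i" "0 < a j" using a[of i] a[of j] ij by auto
      obtain i' x where "z = (i', x)" "i' = i \<or> i' = j" "x < a i'"
        using z by auto
      then show ?thesis using comp[of x 0] comp[of 0 0] comp[of 0 x] pos by auto
    qed
    then have "f ` ?S \<subseteq> {y. y div l = f (i, 0) div l}" by blast
    moreover have "inj_on f ?S" using ij by (intro inj_on_subset[OF f(1)]) auto
    ultimately have "card ?S \<le> l"
      using card_inj_on_le[of f ?S "{y. y div l = f (i, 0) div l}"] card_class[OF l] by simp
    moreover have "card ?S = a i + a j" using ij by (subst card_SigmaI) auto
    moreover have "a 1 \<le> a i" "a 2 \<le> a j"
      using ij mono by (auto intro!: mono_onD[OF mono])
    ultimately show False using a2 by (simp add: l_def)
  qed
  moreover have "\<not> contains_copy (complement_graph (graph_of_rel N R)) (book k n)"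
  proof
    assume "contains_copy (complement_graph (graph_of_rel N R)) (book k n)"
    then obtain f where f: "inj_on f {..<n}"
      and adj: "\<And>u v. u < k \<Longrightarrow> u < n \<Longrightarrow> v < n \<Longrightarrow> u \<noteq> v \<Longrightarrow>
         {f u, f v} \<in> edges (complement_graph (graph_of_rel N R))"
      by (rule book_copyE) (rule that; fast)
    have notR: "\<not> R (f u) (f v)" if "u < 2" "v < n" "u \<noteq> v" for u v
    proof -
      have "{f u, f v} \<in> edges (complement_graph (graph_of_rel N R))"
        using k n that by (intro adj) auto
      then show ?thesis by (auto simp: edge_complement edge)
    qed
    have same: "c (f v) = c (f 0)" if "v < n" for v
      using notR[of 0 v] that by (cases "v = 0") (auto simp: R_def)
    show False
    proof (cases "c (f 0) = 0")
      case False
      have "f ` {..<n} \<subseteq> (\<lambda>y. y + w) ` {y. y div (n - 1) = c (f 0) - 1}"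
      proof
        fix y assume "y \<in> f ` {..<n}"
        then have "c y = c (f 0)" using same by auto
        then have "w \<le> y" "(y - w) div (n - 1) = c (f 0) - 1"
          using False by (auto simp: c_def split: if_splits)
        then show "y \<in> (\<lambda>y. y + w) ` {y. y div (n - 1) = c (f 0) - 1}"
          by (intro image_eqI[of _ _ "y - w"]) auto
      qed
      then have "card (f ` {..<n}) \<le> card ((\<lambda>y. y + w) ` {y. y div (n - 1) = c (f 0) - 1})"
        using card_class(2)[OF n1] by (intro card_mono) auto
      also have "\<dots> \<le> n - 1" using card_class[OF n1] by (metis card_image_le)
      finally show False using card_image[OF f] n by simp
    next
      case True
      have W: "f v < w" if "v < n" for v using same[OF that] True c0 by simp
      \<comment> \<open>Only the last clique can be incomplete, and the two non-adjacent vertices \<open>f 0\<close> and \<open>f 1\<close> cannot both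
        be in it.\<close>
      have "\<exists>u<2. (f u div l + 1) * l \<le> w"
      proof (rule ccontr)
        assume *: "\<not> ?thesis"
        have q: "f u div l = w div l" if "u < 2" for u
        proof -
          have "w < (f u div l + 1) * l" using * that by auto
          then have "w div l < f u div l + 1" by (rule less_mult_imp_div_less)
          moreover have "f u div l \<le> w div l" using W[of u] that n by (intro div_le_mono) auto
          ultimately show ?thesis by simp
        qed
        have "R (f 0) (f 1)" using q[of 0] q[of 1] W[of 0] W[of 1] n by (simp add: R_def c0)
        then show False using notR[of 0 1] n by simp
      qed
      then obtain u where u: "u < 2" "(f u div l + 1) * l \<le> w" by blast
      let ?K = "{y. y div l = f u div l}"
      have K: "?K \<subseteq> {..<w}"
      proof
        fix y assume "y \<in> ?K"
        then have "y < (f u div l + 1) * l"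
          using dividend_less_times_div[OF l, of y] by (simp add: mult.commute)
        then show "y \<in> {..<w}" using u(2) by simp
      qed
      have "f ` {..<n} \<subseteq> {..<w} - (?K - {f u})"
      proof
        fix y assume "y \<in> f ` {..<n}"
        then obtain v where v: "v < n" "y = f v" by blast
        have "f v div l \<noteq> f u div l" if "v \<noteq> u"
          using notR[of u v] u v W[of u] W[of v] that n by (auto simp: R_def c0)
        then show "y \<in> {..<w} - (?K - {f u})" using v W by auto
      qed
      then have "card (f ` {..<n}) \<le> card ({..<w} - (?K - {f u}))" by (intro card_mono) auto
      also have "\<dots> = w - card (?K - {f u})"
        using K card_class(2)[OF l] by (subst card_Diff_subset) auto
      also have "card (?K - {f u}) = a 1" using card_class[OF l] by (simp add: l_def)
      finally show False using card_image[OF f] n by (simp add: w_def)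
    qed
  qed
  ultimately show ?thesis unfolding N_def by (rule not_ramsey_propertyI)
qed

section \<open>The upper bound and the equivalence\<close>

lemma contains_copy_if_family:
  assumes \<Gamma>: "finite_graph \<Gamma>"
    and T: "\<And>i. i \<in> {1..p} \<Longrightarrow> T i \<subseteq> verts \<Gamma> \<and> a i \<le> card (T i)"
    and adj: "\<And>i j x y. i \<in> {1..p} \<Longrightarrow> j \<in> {1..p} \<Longrightarrow> i \<noteq> j \<Longrightarrow> x \<in> T i \<Longrightarrow> y \<in> T j \<Longrightarrow>
       {x, y} \<in> edges \<Gamma>"
  shows "contains_copy \<Gamma> (complete_multipartite p a)"
proof -
  have "\<exists>h. h ` {..<a i} \<subseteq> T i \<and> inj_on h {..<a i}" if "i \<in> {1..p}" for i
  proof (rule card_le_inj)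
    show "finite (T i)" using T[OF that] \<Gamma> by (auto simp: finite_graph_def intro: finite_subset)
  qed (use T[OF that] in auto)
  then obtain h where h: "\<And>i. i \<in> {1..p} \<Longrightarrow> h i ` {..<a i} \<subseteq> T i \<and> inj_on (h i) {..<a i}"
    by metis
  have hT: "h i x \<in> T i" if "i \<in> {1..p}" "x < a i" for i x
    using h[OF that(1)] that(2) by blast
  have loop: "{x, x} \<notin> edges \<Gamma>" for x
    using \<Gamma> by (auto simp: finite_graph_def nsets_def)
  let ?f = "\<lambda>(i, x). h i x"
  show ?thesis
    unfolding contains_copy_multipartite_iff
  proof (intro exI[of _ ?f] conjI allI impI)
    show "inj_on ?f (Sigma {1..p} (\<lambda>i. {..<a i}))"
    proof (rule inj_onI)
      fix z w assume z: "z \<in> Sigma {1..p} (\<lambda>i. {..<a i})" and w: "w \<in> Sigma {1..p} (\<lambda>i. {..<a i})"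
        and eq: "?f z = ?f w"
      obtain i x where ix: "z = (i, x)" "i \<in> {1..p}" "x < a i" using z by auto
      obtain j y where jy: "w = (j, y)" "j \<in> {1..p}" "y < a j" using w by auto
      have eq': "h i x = h j y" using eq ix jy by simp
      have "i = j"
      proof (rule ccontr)
        assume "i \<noteq> j"
        then have "{h i x, h j y} \<in> edges \<Gamma>" using ix jy hT by (intro adj[of i j]) auto
        then show False using eq' loop by simp
      qed
      moreover have "x = y"
        using h[OF ix(2)] eq' ix(3) jy(3) \<open>i = j\<close> by (auto dest: inj_onD)
      ultimately show "z = w" using ix jy by simp
    qed
    show "?f ` Sigma {1..p} (\<lambda>i. {..<a i}) \<subseteq> verts \<Gamma>"
    proof
      fix v assume "v \<in> ?f ` Sigma {1..p} (\<lambda>i. {..<a i})"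
      then obtain i x where "v = h i x" "i \<in> {1..p}" "x < a i" by auto
      then show "v \<in> verts \<Gamma>" using T[of i] hT[of i x] by blast
    qed
  next
    fix i x j y assume "(i \<in> {1..p} \<and> x < a i) \<and> (j \<in> {1..p} \<and> y < a j) \<and> i \<noteq> j"
    then show "{?f (i, x), ?f (j, y)} \<in> edges \<Gamma>"
      using adj[of i j "h i x" "h j y"] hT by simp
  qed
qed

lemma contains_book_if_stable:
  assumes \<Gamma>: "finite_graph \<Gamma>" and k: "k \<le> n"
    and S: "S \<subseteq> verts \<Gamma>" "card S = k" "\<And>x y. x \<in> S \<Longrightarrow> y \<in> S \<Longrightarrow> {x, y} \<notin> edges \<Gamma>"
    and M: "n \<le> card {v \<in> verts \<Gamma>. \<forall>x\<in>S. {v, x} \<notin> edges \<Gamma>}"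
  shows "contains_copy (complement_graph \<Gamma>) (book k n)"
proof -
  let ?M = "{v \<in> verts \<Gamma>. \<forall>x\<in>S. {v, x} \<notin> edges \<Gamma>}"
  have fin: "finite ?M" "finite S"
    using \<Gamma> S(1) by (auto simp: finite_graph_def intro: finite_subset)
  have SM: "S \<subseteq> ?M" using S by blast
  have "n - k \<le> card (?M - S)" using M SM fin S(2) by (simp add: card_Diff_subset)
  then obtain P where P: "P \<subseteq> ?M - S" "card P = n - k" "finite P"
    using obtain_subset_with_card_n[of "n - k" "?M - S"] by blast
  obtain f where f: "bij_betw f {..<k} S"
    using finite_same_card_bij[of "{..<k}" S] fin S(2) by auto
  obtain g where g: "bij_betw g {k..<n} P"
    using finite_same_card_bij[of "{k..<n}" P] P by auto
  let ?h = "\<lambda>v. if v < k then f v else g v"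
  have hS: "?h v \<in> S" if "v < k" for v using f that by (auto simp: bij_betw_def)
  have hP: "?h v \<in> P" if "\<not> v < k" "v < n" for v using g that by (auto simp: bij_betw_def)
  have hM: "?h v \<in> ?M" if "v < n" for v
    using hS[of v] hP[of v] SM P(1) that by blast
  have inj: "inj_on ?h {..<n}"
  proof (rule inj_onI)
    fix u v assume uv: "u \<in> {..<n}" "v \<in> {..<n}" "?h u = ?h v"
    have disj: "S \<inter> P = {}" using P(1) by blast
    consider "u < k" "v < k" | "\<not> u < k" "\<not> v < k" | "u < k" "\<not> v < k" | "\<not> u < k" "v < k" by blast
    then show "u = v"
    proof cases
      case 1
      then show ?thesis using uv f by (auto simp: bij_betw_def dest: inj_onD)
    next
      case 2
      then show ?thesis using uv g by (auto simp: bij_betw_def dest: inj_onD)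
    next
      case 3
      then show ?thesis using uv hS[of u] hP[of v] disj by auto
    next
      case 4
      then show ?thesis using uv hS[of v] hP[of u] disj by auto
    qed
  qed
  show ?thesis
    unfolding contains_copy_book_iff
  proof (intro exI[of _ ?h] conjI allI impI inj)
    show "?h ` {..<n} \<subseteq> verts (complement_graph \<Gamma>)"
    proof (rule image_subsetI)
      fix v assume "v \<in> {..<n}"
      then have "?h v \<in> ?M" by (intro hM) simp
      then show "?h v \<in> verts (complement_graph \<Gamma>)" by (simp add: complement_graph_def)
    qed
  next
    fix u v assume uv: "u < k \<and> u < n \<and> v < n \<and> u \<noteq> v"
    then have "?h u \<noteq> ?h v" using inj_onD[OF inj, of u v] by auto
    moreover have "?h u \<in> S" "?h u \<in> ?M" "?h v \<in> ?M" using uv hS hM by blast+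
    ultimately show "{?h u, ?h v} \<in> edges (complement_graph \<Gamma>)"
      unfolding edge_complement by (simp add: insert_commute)
  qed
qed

lemma ramsey_upper_bound:
  assumes p: "3 \<le> p" and k: "1 \<le> k" and kn: "k \<le> n"
    and a: "\<And>i. i \<in> {1..p} \<Longrightarrow> 1 \<le> a i" "a 1 = 1" "a 2 = 1" "\<And>i. i \<in> {3..p-1} \<Longrightarrow> a i \<le> t"
    and u: "k \<le> u" "p \<le> u" "t \<le> u" "32 \<le> u" "1 \<le> t"
    and n: "2 ^ (u ^ ((13 * k + 22) * p + 1) * u ^ 4) * a p \<le> n"
  shows "ramsey_property (complete_multipartite p a) (book k n) ((p - 1) * (n - 1) + 1)"
  unfolding ramsey_property_def
proof (intro allI impI, elim conjE, rule ccontr)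
  fix \<Gamma> :: "nat graph"
  assume \<Gamma>: "finite_graph \<Gamma>" "card (verts \<Gamma>) = (p - 1) * (n - 1) + 1"
    and "\<not> (contains_copy \<Gamma> (complete_multipartite p a) \<or> contains_copy (complement_graph \<Gamma>) (book k n))"
  then have no: "\<not> contains_copy \<Gamma> (complete_multipartite p a)" "\<not> contains_copy (complement_graph \<Gamma>) (book k n)"
    by auto
  let ?R = "\<lambda>x y. {x, y} \<in> edges \<Gamma>"
  interpret simple_graph "verts \<Gamma>" ?R
  proof
    show "finite (verts \<Gamma>)" using \<Gamma> by (simp add: finite_graph_def)
    show "{y, x} \<in> edges \<Gamma>" if "{x, y} \<in> edges \<Gamma>" for x y
      using that by (simp add: insert_commute)
    show "{x, x} \<notin> edges \<Gamma>" for x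
      using \<Gamma> by (auto simp: finite_graph_def nsets_def)
  qed
  interpret goodness "verts \<Gamma>" ?R k p t "a p" n
  proof
    show "card (verts \<Gamma>) = (p - 1) * (n - 1) + 1" by (rule \<Gamma>(2))
    show "1 \<le> k" "3 \<le> p" "1 \<le> t" "1 \<le> a p" "1 \<le> n" using p k kn u a(1)[of p] by auto
    show "card (miss S) < n" if S: "S \<subseteq> verts \<Gamma>" "stable S" "card S = k" for S
    proof (rule ccontr)
      assume "\<not> ?thesis"
      then have "n \<le> card {v \<in> verts \<Gamma>. \<forall>x\<in>S. {v, x} \<notin> edges \<Gamma>}" by (simp add: miss_def)
      then have "contains_copy (complement_graph \<Gamma>) (book k n)"
        using S by (intro contains_book_if_stable[OF \<Gamma>(1) kn]) (auto simp: stable_def)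
      then show False using no by blast
    qed
    show False
      if xyz: "x < p" "y < p" "z < p" "distinct [x, y, z]"
        and T: "\<And>i. i < p \<Longrightarrow> T i \<subseteq> verts \<Gamma>"
        and compl: "\<And>i j. i < p \<Longrightarrow> j < p \<Longrightarrow> i \<noteq> j \<Longrightarrow> complete_to (T i) (T j)"
        and size: "1 \<le> card (T x)" "1 \<le> card (T y)" "a p \<le> card (T z)"
          "\<And>i. i < p \<Longrightarrow> i \<notin> {x, y, z} \<Longrightarrow> t \<le> card (T i)" for T x y z
    proof -
      have "card ({..<p} - {x, y, z}) = p - 3"
        using xyz by (subst card_Diff_subset) auto
      then have "card {3..p-1} = card ({..<p} - {x, y, z})" using p by simp
      then obtain g where "bij_betw g {3..p-1} ({..<p} - {x, y, z})"
        using finite_same_card_bij[of "{3..p-1}" "{..<p} - {x, y, z}"] by auto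
      then have g: "inj_on g {3..p-1}" "g ` {3..p-1} = {..<p} - {x, y, z}"
        unfolding bij_betw_def by blast+
      have g': "g i < p" "g i \<noteq> x" "g i \<noteq> y" "g i \<noteq> z" if "i \<in> {3..p-1}" for i
        using g(2) that by blast+
      \<comment> \<open>\<open>\<pi>\<close> matches the parts \<open>1\<close>, \<open>2\<close> and \<open>p\<close> of \<open>G\<close> with \<open>x\<close>, \<open>y\<close> and \<open>z\<close>, and the parts of size at most \<open>t\<close>
        with the remaining indices in any order.\<close>
      define \<pi> where "\<pi> = (\<lambda>i. if i = 1 then x else if i = 2 then y else if i = p then z else g i)"
      have cases: "i = 1 \<or> i = 2 \<or> i = p \<or> i \<in> {3..p-1}" if "i \<in> {1..p}" for i
        using that by auto
      have \<pi>p: "\<pi> i < p" if "i \<in> {1..p}" for i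
        using cases[OF that] xyz g'[of i] by (auto simp: \<pi>_def)
      have \<pi>inj: "\<pi> i \<noteq> \<pi> j" if "i \<in> {1..p}" "j \<in> {1..p}" "i \<noteq> j" for i j
        using cases[OF that(1)] cases[OF that(2)] xyz g'[of i] g'[of j] inj_onD[OF g(1), of i j] that(3) p
        by (auto simp: \<pi>_def)
      have "contains_copy \<Gamma> (complete_multipartite p a)"
      proof (rule contains_copy_if_family[OF \<Gamma>(1), where T = "\<lambda>i. T (\<pi> i)"])
        fix i assume i: "i \<in> {1..p}"
        have "a i \<le> card (T (\<pi> i))"
          using cases[OF i]
        proof (elim disjE)
          assume i: "i \<in> {3..p-1}"
          then have "t \<le> card (T (g i))" using g'[OF i] by (intro size(4)) auto
          moreover have "\<pi> i = g i" using i p by (auto simp: \<pi>_def)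
          ultimately show ?thesis using a(4)[OF i] by simp
        qed (use size(1-3) a(2,3) p in \<open>auto simp: \<pi>_def\<close>)
        then show "T (\<pi> i) \<subseteq> verts \<Gamma> \<and> a i \<le> card (T (\<pi> i))" using T[OF \<pi>p[OF i]] by blast
      next
        fix i j v w assume ij: "i \<in> {1..p}" "j \<in> {1..p}" "i \<noteq> j" and vw: "v \<in> T (\<pi> i)" "w \<in> T (\<pi> j)"
        have "complete_to (T (\<pi> i)) (T (\<pi> j))" using ij by (intro compl \<pi>p \<pi>inj)
        then show "{v, w} \<in> edges \<Gamma>" using vw by (auto simp: complete_to_def)
      qed
      then show False using no by blast
    qed
  qed
  show False using contradiction_if_large[OF u(1-4) refl n] .
qed

text \<open>
  For \<open>p = 2\<close> the large part is itself one of the two parts of size \<open>1\<close>, and \<open>G\<close> is a single edge.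
\<close>

lemma ramsey_upper_bound_edge:
  assumes "k \<le> n" "a 1 = 1" "a 2 = 1"
  shows "ramsey_property (complete_multipartite 2 a) (book k n) n"
  unfolding ramsey_property_def
proof (intro allI impI, elim conjE)
  fix \<Gamma> :: "nat graph"
  assume \<Gamma>: "finite_graph \<Gamma>" "card (verts \<Gamma>) = n"
  show "contains_copy \<Gamma> (complete_multipartite 2 a) \<or> contains_copy (complement_graph \<Gamma>) (book k n)"
  proof (cases "edges \<Gamma> = {}")
    case True
    obtain S where "S \<subseteq> verts \<Gamma>" "card S = k"
      using \<Gamma>(2) assms(1) obtain_subset_with_card_n[of k "verts \<Gamma>"] by auto
    then have "contains_copy (complement_graph \<Gamma>) (book k n)"
      using True \<Gamma> by (intro contains_book_if_stable[OF \<Gamma>(1) assms(1)]) auto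
    then show ?thesis ..
  next
    case False
    then obtain e where e: "e \<in> edges \<Gamma>" "e \<in> [verts \<Gamma>]\<^bsup>2\<^esup>" using \<Gamma> by (auto simp: finite_graph_def)
    then obtain x y where xy: "e = {x, y}" "x \<in> verts \<Gamma>" "y \<in> verts \<Gamma>"
      unfolding nsets_def by (auto simp: card_2_iff)
    have "contains_copy \<Gamma> (complete_multipartite 2 a)"
    proof (rule contains_copy_if_family[OF \<Gamma>(1), where T = "\<lambda>i. if i = 1 then {x} else {y}"])
      fix i :: nat assume "i \<in> {1..2}"
      then have "i = 1 \<or> i = 2" by auto
      then show "(if i = 1 then {x} else {y}) \<subseteq> verts \<Gamma> \<and> a i \<le> card (if i = 1 then {x} else {y})"
        using xy assms by auto
    next
      fix i j :: nat and v w assume "i \<in> {1..2}" "j \<in> {1..2}" "i \<noteq> j"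
        "v \<in> (if i = 1 then {x} else {y})" "w \<in> (if j = 1 then {x} else {y})"
      then show "{v, w} \<in> edges \<Gamma>" using e(1) xy(1) by (auto simp: insert_commute split: if_splits)
    qed
    then show ?thesis ..
  qed
qed

text \<open>
  With \<open>u = t ^ (k + p)\<close> the bound needed for \<open>contradiction_if_large\<close> is \<open>t\<close> to a power of about
  \<open>13 * k * p * (k + p)\<close>, and \<open>k + p \<le> k * p\<close>.
\<close>

lemma exponent_bound:
  fixes k p t :: nat
  assumes "2 \<le> k" "2 \<le> p" "2 \<le> t"
  shows "(t ^ (k + p)) ^ ((13 * k + 22) * p + 1) * (t ^ (k + p)) ^ 4 \<le> t ^ (1000 * k\<^sup>2 * p\<^sup>2)"
proof -
  have "k + p \<le> k * p"
  proof -
    obtain i j where "k = i + 2" "p = j + 2" using assms by (metis add.commute le_Suc_ex)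
    then show ?thesis by simp
  qed
  moreover have "(13 * k + 22) * p + 5 \<le> 27 * (k * p)"
  proof -
    have "22 * p \<le> 11 * (k * p)" using mult_right_mono[OF assms(1), of "11 * p"] by (simp add: mult_ac)
    moreover have "2 * 2 \<le> k * p" using assms by (intro mult_mono) auto
    moreover have "(13 * k + 22) * p + 5 = 13 * (k * p) + 22 * p + 5" by (simp add: algebra_simps)
    ultimately show ?thesis by linarith
  qed
  ultimately have "(k + p) * ((13 * k + 22) * p + 5) \<le> (k * p) * (27 * (k * p))"
    by (intro mult_mono) auto
  also have "\<dots> \<le> 1000 * k\<^sup>2 * p\<^sup>2" by (simp add: power2_eq_square)
  finally have "t ^ ((k + p) * ((13 * k + 22) * p + 5)) \<le> t ^ (1000 * k\<^sup>2 * p\<^sup>2)"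
    using assms by (intro power_increasing) auto
  moreover have "(13 * k + 22) * p + 1 + 4 = (13 * k + 22) * p + 5" by simp
  ultimately show ?thesis
    by (simp only: power_mult[symmetric] power_add[symmetric] add_mult_distrib2[symmetric])
qed

theorem theorem1p3:
  fixes k p t :: nat
  assumes "k \<ge> 2" and "p \<ge> 2" and "t \<ge> 2"
  shows "\<exists>\<delta>::real. \<delta> > 0 \<and>
           \<delta> \<ge> 2 powr (- (real t ^ (1000 * k\<^sup>2 * p\<^sup>2))) \<and>
           (\<forall>n::nat. n \<ge> 1 \<longrightarrow>
             (\<forall>a :: nat \<Rightarrow> nat.
               (\<forall>i\<in>{1..p}. a i \<ge> 1) \<and> mono_on {1..p} a \<and>
               a (p - 1) \<le> t \<and> real (a p) \<le> \<delta> * real n \<longrightarrow>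
               (ramsey_number (complete_multipartite p a) (book k n) = (p - 1) * (n - 1) + a 1
                  \<longleftrightarrow> a 1 = 1 \<and> a 2 = 1)))"
proof (intro exI[of _ "2 powr (- (real t ^ (1000 * k\<^sup>2 * p\<^sup>2)))"] conjI allI impI)
  fix n :: nat and a :: "nat \<Rightarrow> nat"
  assume "(\<forall>i\<in>{1..p}. a i \<ge> 1) \<and> mono_on {1..p} a \<and> a (p - 1) \<le> t \<and>
     real (a p) \<le> 2 powr (- (real t ^ (1000 * k\<^sup>2 * p\<^sup>2))) * real n"
  then have a: "\<And>i. i \<in> {1..p} \<Longrightarrow> 1 \<le> a i" "mono_on {1..p} a" "a (p - 1) \<le> t"
     and ap: "real (a p) \<le> 2 powr (- (real t ^ (1000 * k\<^sup>2 * p\<^sup>2))) * real n" by auto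
  define \<Lambda> where "\<Lambda> = t ^ (1000 * k\<^sup>2 * p\<^sup>2)"
  have large: "2 ^ \<Lambda> * a p \<le> n"
  proof -
    have "2 powr (- (real t ^ (1000 * k\<^sup>2 * p\<^sup>2))) = 1 / 2 ^ \<Lambda>"
      by (simp add: \<Lambda>_def powr_minus_divide powr_realpow[symmetric])
    then have "real (a p) \<le> 1 / 2 ^ \<Lambda> * real n" using ap by (simp only:)
    then have "real (2 ^ \<Lambda> * a p) \<le> real n" by (simp add: field_simps)
    then show ?thesis by (simp only: of_nat_le_iff)
  qed
  define u where "u = t ^ (k + p)"
  have kpu: "k + p \<le> u" 
  proof -
    have "k + p \<le> 2 ^ (k + p)" by (simp add: less_imp_le)
    also have "\<dots> \<le> u" unfolding u_def using assms by (intro power_mono) auto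
    finally show ?thesis .
  qed
  have u\<Lambda>: "u ^ ((13 * k + 22) * p + 1) * u ^ 4 \<le> \<Lambda>"
    unfolding u_def \<Lambda>_def using assms by (rule exponent_bound)
  have "u ^ 1 * 1 \<le> u ^ ((13 * k + 22) * p + 1) * u ^ 4"
    using kpu assms by (intro mult_mono power_increasing one_le_power) auto
  then have "u \<le> \<Lambda>" unfolding power_one_right mult_1_right using u\<Lambda> by (rule order_trans)
  also have "\<Lambda> \<le> 2 ^ \<Lambda>" by (simp add: less_imp_le)
  also have "\<dots> \<le> n" using large a(1)[of p] assms by (metis atLeastAtMost_iff le_trans mult.right_neutral mult_le_mono2 one_le_numeral order_refl)
  finally have kn: "k + p \<le> n" using kpu by simp
  show "ramsey_number (complete_multipartite p a) (book k n) = (p - 1) * (n - 1) + a 1 \<longleftrightarrow>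
      a 1 = 1 \<and> a 2 = 1"
  proof
    assume *: "ramsey_number (complete_multipartite p a) (book k n) = (p - 1) * (n - 1) + a 1"
    have "ramsey_property (complete_multipartite p a) (book k n) ((p - 1) * (n - 1) + a 1)"
      unfolding *[symmetric] ramsey_number_def
      by (rule LeastI_ex, rule ramsey_number_exists[OF finite_graph_complete_multipartite finite_graph_book])
    then have "\<not> 2 \<le> a 2"
      using clique_component_lower_bound[of p k n a] a assms kn by auto
    moreover have "1 \<le> a 1" "a 1 \<le> a 2" using a(1)[of 1] mono_onD[OF a(2), of 1 2] assms by auto
    ultimately show "a 1 = 1 \<and> a 2 = 1" by simp
  next
    assume *: "a 1 = 1 \<and> a 2 = 1"
    have upper: "ramsey_property (complete_multipartite p a) (book k n) ((p - 1) * (n - 1) + 1)"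
    proof (cases "p = 2")
      case True
      then show ?thesis using ramsey_upper_bound_edge[of k n a] * kn by simp
    next
      case False
      then have p3: "3 \<le> p" using assms by simp
      have "(2::nat) ^ 5 \<le> 2 ^ (k + p)" using p3 assms by (intro power_increasing) auto
      also have "\<dots> \<le> u" unfolding u_def using assms by (intro power_mono) auto
      finally have "32 \<le> u" by simp
      moreover have "t ^ 1 \<le> u" unfolding u_def using assms by (intro power_increasing) auto
      moreover have "a i \<le> t" if "i \<in> {3..p-1}" for i
      proof -
        have "a i \<le> a (p - 1)" using that by (intro mono_onD[OF a(2)]) auto
        then show ?thesis using a(3) by simp
      qed
      moreover have "2 ^ (u ^ ((13 * k + 22) * p + 1) * u ^ 4) * a p \<le> n"
      proof -
        have "(2::nat) ^ (u ^ ((13 * k + 22) * p + 1) * u ^ 4) * a p \<le> 2 ^ \<Lambda> * a p"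
          using u\<Lambda> by (intro mult_right_mono power_increasing) auto
        then show ?thesis using large by (rule order_trans)
      qed
      ultimately show ?thesis
        using p3 assms kn kpu * a(1) by (intro ramsey_upper_bound[where t = t and u = u]) auto
    qed
    have "(p - 1) * (n - 1) + 1 \<le> N"
      if "ramsey_property (complete_multipartite p a) (book k n) N" for N
      using multipartite_lower_bound[of p k n a N] that a(1) assms kn by fastforce
    then show "ramsey_number (complete_multipartite p a) (book k n) = (p - 1) * (n - 1) + a 1"
      unfolding ramsey_number_def using upper * by (simp add: Least_equality)
  qed
qed simp_all

end
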